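(* Let $b\ge2$ and $d\ge b$ be integers, let $p=(p_0,\dots,p_{d-1})$ be a positive probability vector, and let $\eta=\eta_{b,p}$ be the associated Bernoulli convolution. The measures $\eta_{q,symb}$ and $\eta_{sum,symb}$ are sofic, as well as the measure $\eta'$ on $\{0,\dots,b-1\}^{\mathbb N}$ defined by $$\eta'[\varepsilon_1\dots\varepsilon_k]:=\eta_{sum,symb}[\varepsilon_k\dots\varepsilon_1].$$ Moreover $\eta'$ is the continuous image, by the map $i\mapsto\big\lfloor\frac{i}{a+1}\big\rfloor$ (applied letter by letter), of the Markov measure on $\{0,1,\dots,(a+1)b-1\}^{\mathbb N}$ of transition matrix $$P_{\eta'}:=\begin{pmatrix}{}^tM_0&{}^tM_1&\dots&{}^tM_{b-1}\\\vdots&\vdots&\ddots&\vdots\\{}^tM_0&{}^tM_1&\dots&{}^tM_{b-1}\end{pmatrix}$$ (with $b$ identical block rows) and initial probability vector $\begin{pmatrix}{}^tC&\dots&{}^tC\end{pmatrix}$ (with $b$ blocks).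
   Context: $\mathbb N=\{1,2,\dots\}$ and ${}^tA$ is the transpose of $A$. The Bernoulli convolution is the probability measure on $\mathbb R$ defined by $\eta_{b,p}(I)=P_p\big(\{(\omega_k)_{k\in\mathbb N}: 0\le\omega_k\le d-1,\ \sum_{k\ge1}\omega_kb^{-k}\in I\}\big)$ for every interval $I$, where $P_p$ is the product probability on $\{0,\dots,d-1\}^{\mathbb N}$ determined by $p$. Let $a=\left\lceil\frac{d-1}{b-1}\right\rceil-1$ and, for $j\in\{0,\dots,b-1\}$, $M_j=(p_{j+bq-q'})_{0\le q\le a,\ 0\le q'\le a}$ (row $q$, column $q'$, with $p_i=0$ for $i\notin\{0,\dots,d-1\}$). $C$ is the unique positive column eigenvector of the irreducible matrix $\sum_jM_j$ whose entries sum to $1$. For $\varepsilon_1,\dots,\varepsilon_k\in\{0,\dots,b-1\}$ let $I_{\varepsilon_1\dots\varepsilon_k}=\big[\sum_{i=1}^k\varepsilon_ib^{-i},\ \sum_{i=1}^k\varepsilon_ib^{-i}+b^{-k}\big)$, and let $[\varepsilon_1\dots\varepsilon_k]$ be the cylinder set of sequences in $\{0,\dots,b-1\}^{\mathbb N}$ beginning with $\varepsilon_1\dots\varepsilon_k$. Define the probability measures on $\{0,\dots,b-1\}^{\mathbb N}$ $$\eta_{q,symb}[\varepsilon_1\dots\varepsilon_k]:=\frac{\eta(q+I_{\varepsilon_1\dots\varepsilon_k})}{\eta(q+[0,1))},\qquad \eta_{sum,symb}[\varepsilon_1\dots\varepsilon_k]:=\sum_{q=0}^\infty\eta(q+I_{\varepsilon_1\dots\varepsilon_k}),$$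 the first for integers $q\ge0$ with $\eta(q+[0,1))>0$ (i.e. $0\le q\le a$). A (homogeneous, not necessarily shift-invariant) Markov probability measure on $\{0,\dots,m-1\}^{\mathbb N}$, with initial vector a positive probability vector $(\pi_0,\dots,\pi_{m-1})$ and transition matrix a nonnegative stochastic matrix $(p_{ij})_{0\le i,j\le m-1}$, is the measure $\mu$ with $\mu[\omega_1\dots\omega_n]=\pi_{\omega_1}p_{\omega_1\omega_2}\cdots p_{\omega_{n-1}\omega_n}$. A probability measure on $\{0,\dots,b-1\}^{\mathbb N}$ is sofic if it is the image of a Markov probability measure on some $\{0,\dots,m-1\}^{\mathbb N}$ by a continuous map commuting with the shift (which can be chosen of the form $(\omega_n)_n\mapsto(\psi(\omega_n))_n$ for a map $\psi:\{0,\dots,m-1\}\to\{0,\dots,b-1\}$).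
   Formalization: The initial vector (tC ... tC), whose entries sum to b, is replaced by (1/b)(tC ... tC)P_{eta'} = (tC tM_0, ..., tC tM_{b-1}); initial vectors of Markov measures may have zero entries instead of being strictly positive, since otherwise some eta_{q,symb} is not sofic. *)

theory Defs
  imports "HOL-Probability.Probability" "Jordan_Normal_Form.Char_Poly"
begin

unbundle no vec_syntax

text \<open>Sequences $(\omega_k)_{k \ge 1}$ are functions on \<^typ>\<open>nat\<close> shifted by one:
  \<open>\<omega> 0\<close> is the first letter. Words are lists.\<close>

definition bernoulli_conv :: "nat \<Rightarrow> nat \<Rightarrow> (nat \<Rightarrow> real) \<Rightarrow> real measure" where
  "bernoulli_conv b d p =
     distr (\<Pi>\<^sub>M k\<in>(UNIV :: nat set). point_measure {..<d} (\<lambda>i. ennreal (p i))) borel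
       (\<lambda>\<omega>. \<Sum>k. real (\<omega> k) / real b ^ Suc k)"

definition seq_space :: "nat \<Rightarrow> (nat \<Rightarrow> nat) measure" where
  "seq_space m = (\<Pi>\<^sub>M n\<in>(UNIV :: nat set). count_space {..<m})"

definition cylinder :: "nat \<Rightarrow> nat list \<Rightarrow> (nat \<Rightarrow> nat) set" where
  "cylinder m w = {\<omega> \<in> space (seq_space m). \<forall>i<length w. \<omega> i = w ! i}"

definition cylinder_measure :: "nat \<Rightarrow> (nat list \<Rightarrow> real) \<Rightarrow> (nat \<Rightarrow> nat) measure \<Rightarrow> bool" where
  "cylinder_measure m f \<mu> \<longleftrightarrow>
     prob_space \<mu> \<and> sets \<mu> = sets (seq_space m) \<and>
     (\<forall>w \<in> lists {..<m}. w \<noteq> [] \<longrightarrow> measure \<mu> (cylinder m w) = f w)"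

text \<open>Cylinders generate the \<open>\<sigma>\<close>-algebra and are closed under intersection, so there is at most
  one such measure; the description is only meaningful if one exists.\<close>

definition measure_of_cylinders :: "nat \<Rightarrow> (nat list \<Rightarrow> real) \<Rightarrow> (nat \<Rightarrow> nat) measure" where
  "measure_of_cylinders m f = (THE \<mu>. cylinder_measure m f \<mu>)"

definition prob_vec :: "real vec \<Rightarrow> bool" where
  "prob_vec v \<longleftrightarrow> (\<forall>i<dim_vec v. 0 \<le> v $ i) \<and> (\<Sum>i<dim_vec v. v $ i) = 1"

definition stochastic_mat :: "nat \<Rightarrow> real mat \<Rightarrow> bool" where
  "stochastic_mat m P \<longleftrightarrow> P \<in> carrier_mat m m \<and> (\<forall>i<m. prob_vec (row P i))"

text \<open>``Positive probability vector'' is read as nonnegative for the initial vector. With strictly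
  positive initial vectors, every sofic measure \<open>\<nu>\<close> would satisfy \<open>\<nu>[jw] = 0\<close> whenever
  \<open>\<nu>[w] = 0\<close>; for $b = 3$, $d = 4$, $q = a = 1$ this fails for $\eta_{q,symb}$, since $\eta$ has
  support $[0, 3/2]$, whence $\eta_{1,symb}[2] = 0 < \eta_{1,symb}[02]$.\<close>

definition markov_measure ::
    "nat \<Rightarrow> real vec \<Rightarrow> real mat \<Rightarrow> (nat \<Rightarrow> nat) measure \<Rightarrow> bool" where
  "markov_measure m \<pi> P \<mu> \<longleftrightarrow>
     \<pi> \<in> carrier_vec m \<and> prob_vec \<pi> \<and> stochastic_mat m P \<and>
     cylinder_measure m
       (\<lambda>w. \<pi> $ (w ! 0) * (\<Prod>i<length w - 1. P $$ (w ! i, w ! Suc i))) \<mu>"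

definition shift :: "(nat \<Rightarrow> nat) \<Rightarrow> nat \<Rightarrow> nat" where
  "shift \<omega> = (\<lambda>n. \<omega> (Suc n))"

text \<open>Continuity refers to the product topology on \<^typ>\<open>nat \<Rightarrow> nat\<close>, with \<^typ>\<open>nat\<close> discrete.\<close>

definition sofic :: "nat \<Rightarrow> (nat \<Rightarrow> nat) measure \<Rightarrow> bool" where
  "sofic b \<nu> \<longleftrightarrow>
     (\<exists>m \<pi> P \<mu> \<phi>. markov_measure m \<pi> P \<mu> \<and>
        \<phi> \<in> space (seq_space m) \<rightarrow> space (seq_space b) \<and>
        continuous_on (space (seq_space m)) \<phi> \<and>
        (\<forall>\<omega> \<in> space (seq_space m). \<phi> (shift \<omega>) = shift (\<phi> \<omega>)) \<and>
        \<nu> = distr \<mu> (seq_space b) \<phi>)"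

definition a_of :: "nat \<Rightarrow> nat \<Rightarrow> nat" where
  "a_of b d = nat (\<lceil>(real d - 1) / (real b - 1)\<rceil> - 1)"

definition p_ext :: "nat \<Rightarrow> (nat \<Rightarrow> real) \<Rightarrow> int \<Rightarrow> real" where
  "p_ext d p i = (if 0 \<le> i \<and> i < int d then p (nat i) else 0)"

definition M_mat :: "nat \<Rightarrow> nat \<Rightarrow> (nat \<Rightarrow> real) \<Rightarrow> nat \<Rightarrow> real mat" where
  "M_mat b d p j = mat (a_of b d + 1) (a_of b d + 1)
     (\<lambda>(q, q'). p_ext d p (int j + int b * int q - int q'))"

definition M_sum :: "nat \<Rightarrow> nat \<Rightarrow> (nat \<Rightarrow> real) \<Rightarrow> real mat" where
  "M_sum b d p = mat (a_of b d + 1) (a_of b d + 1) (\<lambda>ij. \<Sum>j<b. M_mat b d p j $$ ij)"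

definition C_vec :: "nat \<Rightarrow> nat \<Rightarrow> (nat \<Rightarrow> real) \<Rightarrow> real vec" where
  "C_vec b d p = (THE v. (\<exists>k. eigenvector (M_sum b d p) v k) \<and>
     (\<forall>i<dim_vec v. 0 < v $ i) \<and> (\<Sum>i<dim_vec v. v $ i) = 1)"

definition word_interval :: "nat \<Rightarrow> nat list \<Rightarrow> real set" where
  "word_interval b w =
     (let x = \<Sum>i<length w. real (w ! i) / real b ^ Suc i in {x ..< x + 1 / real b ^ length w})"

definition eta_q_weight :: "nat \<Rightarrow> nat \<Rightarrow> (nat \<Rightarrow> real) \<Rightarrow> nat \<Rightarrow> nat list \<Rightarrow> real" where
  "eta_q_weight b d p q w =
     measure (bernoulli_conv b d p) ((\<lambda>x. real q + x) ` word_interval b w) /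
     measure (bernoulli_conv b d p) ((\<lambda>x. real q + x) ` {0..<1})"

definition eta_q_symb :: "nat \<Rightarrow> nat \<Rightarrow> (nat \<Rightarrow> real) \<Rightarrow> nat \<Rightarrow> (nat \<Rightarrow> nat) measure" where
  "eta_q_symb b d p q = measure_of_cylinders b (eta_q_weight b d p q)"

definition eta_sum_weight :: "nat \<Rightarrow> nat \<Rightarrow> (nat \<Rightarrow> real) \<Rightarrow> nat list \<Rightarrow> real" where
  "eta_sum_weight b d p w =
     (\<Sum>q. measure (bernoulli_conv b d p) ((\<lambda>x. real q + x) ` word_interval b w))"

definition eta_sum_symb :: "nat \<Rightarrow> nat \<Rightarrow> (nat \<Rightarrow> real) \<Rightarrow> (nat \<Rightarrow> nat) measure" where
  "eta_sum_symb b d p = measure_of_cylinders b (eta_sum_weight b d p)"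

definition eta'_weight :: "nat \<Rightarrow> nat \<Rightarrow> (nat \<Rightarrow> real) \<Rightarrow> nat list \<Rightarrow> real" where
  "eta'_weight b d p w = measure (eta_sum_symb b d p) (cylinder b (rev w))"

definition eta' :: "nat \<Rightarrow> nat \<Rightarrow> (nat \<Rightarrow> real) \<Rightarrow> (nat \<Rightarrow> nat) measure" where
  "eta' b d p = measure_of_cylinders b (eta'_weight b d p)"

text \<open>State \<open>i\<close> lies in block \<open>i div (a + 1)\<close>, at position \<open>i mod (a + 1)\<close>.\<close>

definition P_eta' :: "nat \<Rightarrow> nat \<Rightarrow> (nat \<Rightarrow> real) \<Rightarrow> real mat" where
  "P_eta' b d p = (let n = a_of b d + 1 in
     mat (n * b) (n * b)
       (\<lambda>(i, j). transpose_mat (M_mat b d p (j div n)) $$ (i mod n, j mod n)))"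

definition C_blocks :: "nat \<Rightarrow> nat \<Rightarrow> (nat \<Rightarrow> real) \<Rightarrow> real vec" where
  "C_blocks b d p = (let n = a_of b d + 1 in vec (n * b) (\<lambda>i. C_vec b d p $ (i mod n)))"

text \<open>The row vector $({}^tC \dots {}^tC)$ has total mass $b$, and even after normalisation it cannot
  be the law of the first letter in \<^const>\<open>markov_measure\<close>: all blocks would get mass $1/b$, whereas
  $\eta'[\varepsilon] = \sum_q (M_\varepsilon C)_q$. It is the initial vector at time $0$ of a chain
  observed from time $1$ on, so the law of the first observed state is
  $\frac1b ({}^tC \dots {}^tC) P_{\eta'} = ({}^tC\,{}^tM_0 \dots {}^tC\,{}^tM_{b-1})$.\<close>

definition initial_eta' :: "nat \<Rightarrow> nat \<Rightarrow> (nat \<Rightarrow> real) \<Rightarrow> real vec" where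
  "initial_eta' b d p =
     (1 / real b) \<cdot>\<^sub>v (transpose_mat (P_eta' b d p) *\<^sub>v C_blocks b d p)"

end

theory Submission
  imports Defs
begin

text \<open>
  Write \<open>X = (\<Sum>k. \<omega> k / b ^ Suc k)\<close> for the random sum whose law is \<open>\<eta>\<close>. Removing the first digit
  gives \<open>X = (\<omega> 0 + X') / b\<close>, where \<open>X'\<close> has the law of \<open>X\<close> and is independent of \<open>\<omega> 0\<close>. The event
  that \<open>X\<close> lies in \<open>q + I\<close>, with \<open>I\<close> the interval of the word \<open>\<epsilon> # w\<close>, is therefore the event that
  \<open>X'\<close> lies in \<open>b q + \<epsilon> - \<omega> 0 + I'\<close>, with \<open>I'\<close> the interval of \<open>w\<close>. Since \<open>X\<close> lives in
  \<open>[0, (d - 1) / (b - 1)]\<close> and the right end point carries no mass, only the translates by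
  \<open>0, ..., a\<close> count, and the column of their masses for the word \<open>\<epsilon>\<^sub>1 ... \<epsilon>\<^sub>k\<close> is the matrix product
  \<open>M(\<epsilon>\<^sub>1) ... M(\<epsilon>\<^sub>k) C\<close> (lemmas \<open>self_similar\<close>, \<open>mass_Cons\<close>, \<open>mass_eq_word_act\<close>).

  A formula of this kind with matrices whose sum is row-stochastic describes a hidden Markov chain:
  if \<open>N(0), ..., N(b - 1)\<close> are nonnegative and \<open>\<Sum>\<^sub>j N(j)\<close> has row sums 1, then the pairs (letter, row index)
  form a Markov chain in which \<open>N(\<epsilon>) q r\<close> is the probability to emit \<open>\<epsilon>\<close> and to move from \<open>q\<close> to \<open>r\<close>,
  and started from the law \<open>c\<close> the emitted word is \<open>\<epsilon>\<^sub>1 ... \<epsilon>\<^sub>k\<close> with probability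
  \<open>c N(\<epsilon>\<^sub>1) ... N(\<epsilon>\<^sub>k) 1\<close> (theorem \<open>block_chain\<close>). The matrices \<open>M(j)\<close> can be made
  stochastic in two ways.

  \<^item> The vector \<open>C\<close> is fixed by \<open>\<Sum>\<^sub>j M(j)\<close>, because a unit interval is the disjoint union of its \<open>b\<close>
    subintervals. Hence conjugation by the diagonal matrix of \<open>C\<close> yields row sums 1. Starting the
    chain at \<open>q\<close> gives the measure of the \<open>q\<close>-th unit interval, starting it from the law \<open>C\<close> gives
    the sum over all unit intervals.

  \<^item> The columns of \<open>\<Sum>\<^sub>j M(j)\<close> sum to 1, because for fixed \<open>r\<close> each digit occurs exactly
    once as \<open>j + b q - r\<close>. Hence the transposed matrices are stochastic as they are. Transposition reverses the
    order of the factors, which is the reversal of words in the definition of \<open>\<eta>'\<close>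
    (lemma \<open>word_act_transpose\<close>), and the resulting chain has the stated transition matrix.

  What remains is to recognise the masses of the unit intervals as the eigenvector \<open>C_vec\<close>, which is
  specified as the only positive one of total 1. The column sums force the eigenvalue 1, and uniqueness then
  is a minimum principle: the matrix \<open>\<Sum>\<^sub>j M(j)\<close> has positive entries next to and on the diagonal, so a
  nonnegative fixed vector with one zero entry vanishes (lemma \<open>transfer_irreducible\<close>).
\<close>

section \<open>Measures on sequences and their cylinders\<close>

lemma space_seq_space: "space (seq_space m) = {\<omega>. \<forall>n. \<omega> n < m}"
  by (auto simp: seq_space_def space_PiM PiE_def Pi_def)

lemma cylinder_conv_prefix:
  "cylinder m w = {\<omega> \<in> space (seq_space m). map \<omega> [0..<length w] = w}"
proof -
  have "map \<omega> [0..<length w] = w \<longleftrightarrow> (\<forall>i<length w. \<omega> i = w ! i)" for \<omega>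
    by (subst list_eq_iff_nth_eq) simp
  then show ?thesis unfolding cylinder_def by (simp only:)
qed

lemma cylinder_in_sets [measurable, simp]: "cylinder m w \<in> sets (seq_space m)"
proof (cases "set w \<subseteq> {..<m}")
  case True
  have "cylinder m w =
      {\<omega> \<in> space (seq_space m). \<forall>i\<in>{..<length w}. \<omega> i \<in> {w ! i}}"
    by (auto simp: cylinder_def)
  also have "\<dots> = prod_emb UNIV (\<lambda>_. count_space {..<m}) {..<length w} (\<Pi>\<^sub>E i\<in>{..<length w}. {w ! i})"
    by (auto simp: prod_emb_def seq_space_def space_PiM PiE_def Pi_def extensional_def restrict_def)
  also have "\<dots> \<in> sets (seq_space m)"
    unfolding seq_space_def using True by (intro sets_PiM_I_finite sets_PiM_I) (auto dest: nth_mem)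
  finally show ?thesis .
next
  case False
  then obtain i where "i < length w" "\<not> w ! i < m"
    by (auto simp: in_set_conv_nth subset_eq)
  then have "cylinder m w = {}"
    unfolding cylinder_def space_seq_space by (metis (mono_tags, lifting) empty_Collect_eq mem_Collect_eq)
  then show ?thesis by simp
qed

text \<open>An event about the first \<open>k\<close> letters is a finite disjoint union of cylinders; the
  uniqueness of a measure with given cylinder masses and the cylinder masses of the image of a chain
  under a map of letters both reduce to this.\<close>
lemma measure_prefix_event:
  assumes "finite_measure \<mu>" and [measurable_cong]: "sets \<mu> = sets (seq_space m)"
  shows "measure \<mu> {\<omega> \<in> space (seq_space m). Q (map \<omega> [0..<k])} =
    (\<Sum>u | set u \<subseteq> {..<m} \<and> length u = k \<and> Q u. measure \<mu> (cylinder m u))"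
proof -
  interpret finite_measure \<mu> by fact
  let ?U = "{u. set u \<subseteq> {..<m} \<and> length u = k \<and> Q u}"
  have union: "{\<omega> \<in> space (seq_space m). Q (map \<omega> [0..<k])} = (\<Union>u\<in>?U. cylinder m u)"
  proof (intro Set.set_eqI iffI)
    fix \<omega> assume "\<omega> \<in> {\<omega> \<in> space (seq_space m). Q (map \<omega> [0..<k])}"
    then have "map \<omega> [0..<k] \<in> ?U" "\<omega> \<in> cylinder m (map \<omega> [0..<k])"
      by (auto simp: cylinder_conv_prefix space_seq_space)
    then show "\<omega> \<in> (\<Union>u\<in>?U. cylinder m u)" by blast
  qed (auto simp: cylinder_conv_prefix)
  show ?thesis
    unfolding union
  proof (rule finite_measure_finite_Union)
    show "finite ?U"
      by (rule finite_subset[OF _ finite_lists_length_eq[of "{..<m}" k]]) auto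
    show "cylinder m ` ?U \<subseteq> sets \<mu>"
      unfolding assms(2) by auto
    show "disjoint_family_on (cylinder m) ?U"
      by (auto simp: disjoint_family_on_def cylinder_conv_prefix)
  qed
qed

lemma cylinder_measure_unique:
  assumes \<mu>: "cylinder_measure m f \<mu>" and \<nu>: "cylinder_measure m f \<nu>"
  shows "\<mu> = \<nu>"
proof (rule measure_eqI_PiM_infinite)
  show "sets \<mu> = sets (\<Pi>\<^sub>M n\<in>(UNIV :: nat set). count_space {..<m})"
    and "sets \<nu> = sets (\<Pi>\<^sub>M n\<in>(UNIV :: nat set). count_space {..<m})"
    using \<mu> \<nu> by (simp_all add: cylinder_measure_def seq_space_def)
  interpret M: prob_space \<mu> using \<mu> by (simp add: cylinder_measure_def)
  interpret N: prob_space \<nu> using \<nu> by (simp add: cylinder_measure_def)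
  show "finite_measure \<mu>" by unfold_locales
  fix A :: "nat \<Rightarrow> nat set" and J :: "nat set"
  assume J: "finite J"
  (* Words are required to be nonempty, so k must be positive even if J is empty. *)
  obtain k where k: "k > 0" "J \<subseteq> {..<k}"
  proof
    show "Suc (Max (insert 0 J)) > 0" by simp
    show "J \<subseteq> {..<Suc (Max (insert 0 J))}" using J by (auto simp: less_Suc_eq_le)
  qed
  let ?Q = "\<lambda>u. \<forall>j\<in>J. u ! j \<in> A j"
  have emb: "prod_emb UNIV (\<lambda>n. count_space {..<m}) J (Pi\<^sub>E J A) =
      {\<omega> \<in> space (seq_space m). ?Q (map \<omega> [0..<k])}"
    using k by (auto simp: prod_emb_def seq_space_def space_PiM PiE_def Pi_def extensional_def subset_eq)
  have "measure \<mu> (cylinder m u) = measure \<nu> (cylinder m u)" if "set u \<subseteq> {..<m}" "length u = k" for u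
  proof -
    have "u \<in> lists {..<m}" "u \<noteq> []" using that k by auto
    then show ?thesis using \<mu> \<nu> by (simp add: cylinder_measure_def)
  qed
  then have "(\<Sum>u | set u \<subseteq> {..<m} \<and> length u = k \<and> ?Q u. measure \<mu> (cylinder m u)) =
      (\<Sum>u | set u \<subseteq> {..<m} \<and> length u = k \<and> ?Q u. measure \<nu> (cylinder m u))"
    by (intro sum.cong) auto
  moreover have "sets \<mu> = sets (seq_space m)" "sets \<nu> = sets (seq_space m)"
    using \<mu> \<nu> by (simp_all add: cylinder_measure_def)
  ultimately have "measure \<mu> {\<omega> \<in> space (seq_space m). ?Q (map \<omega> [0..<k])} =
      measure \<nu> {\<omega> \<in> space (seq_space m). ?Q (map \<omega> [0..<k])}"
    using measure_prefix_event[OF M.finite_measure_axioms, of m ?Q k]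
      measure_prefix_event[OF N.finite_measure_axioms, of m ?Q k] by presburger
  then show "emeasure \<mu> (prod_emb UNIV (\<lambda>n. count_space {..<m}) J (Pi\<^sub>E J A)) =
      emeasure \<nu> (prod_emb UNIV (\<lambda>n. count_space {..<m}) J (Pi\<^sub>E J A))"
    unfolding emb M.emeasure_eq_measure N.emeasure_eq_measure by (simp only:)
qed

lemma measure_of_cylinders_eqI:
  assumes "cylinder_measure m f \<mu>"
  shows "measure_of_cylinders m f = \<mu>"
  unfolding measure_of_cylinders_def
  using assms cylinder_measure_unique by blast

section \<open>Existence of Markov measures\<close>

lemma ex_pmf_of_prob_vec:
  assumes "\<And>i. i < m \<Longrightarrow> 0 \<le> g i" and "(\<Sum>i<m. g i) = 1"
  shows "\<exists>R :: nat pmf. \<forall>i. pmf R i = (if i < m then g i else 0)"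
proof -
  let ?h = "\<lambda>i. if i < m then g i else 0"
  have "(\<integral>\<^sup>+x. ennreal (?h x) \<partial>count_space UNIV) = (\<Sum>x<m. ennreal (?h x))"
    by (rule nn_integral_count_space') auto
  also have "\<dots> = 1" using assms by (subst sum_ennreal) auto
  finally show ?thesis using assms
    by (intro exI[of _ "embed_pmf ?h"] allI pmf_embed_pmf) auto
qed

text \<open>A Markov chain is driven by independent random maps of the state space, \<open>\<omega> k\<close> moving
  the chain at time \<open>k\<close>. The extra state \<open>m\<close> carries the initial law; the reduction modulo \<open>m\<close>
  only serves to keep the path inside \<open>{..<m}\<close> on the null set where a map leaves it.\<close>

primrec driven_path :: "nat \<Rightarrow> (nat \<Rightarrow> nat \<Rightarrow> nat) \<Rightarrow> nat \<Rightarrow> nat" where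
  "driven_path m \<omega> 0 = \<omega> 0 m mod m"
| "driven_path m \<omega> (Suc k) = \<omega> (Suc k) (driven_path m \<omega> k) mod m"

lemma measurable_driven_path:
  assumes "m > 0"
  shows "(\<lambda>\<omega>. driven_path m \<omega> k) \<in>
    (\<Pi>\<^sub>M n\<in>(UNIV :: nat set). measure_pmf F) \<rightarrow>\<^sub>M count_space {..<m}" (is "_ \<in> ?B \<rightarrow>\<^sub>M _")
proof -
  have app: "(\<lambda>\<omega>. \<omega> k i mod m) \<in> ?B \<rightarrow>\<^sub>M count_space {..<m}" for k i :: nat
  proof -
    have "(\<lambda>f :: nat \<Rightarrow> nat. f i mod m) \<in> measure_pmf F \<rightarrow>\<^sub>M count_space {..<m}"
      using assms by simp
    then show ?thesis
      by (rule measurable_compose[rotated]) (rule measurable_component_singleton, simp)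
  qed
  show ?thesis
  proof (induction k)
    case 0
    show ?case using app[of 0 m] by simp
  next
    case (Suc k)
    have "(\<lambda>\<omega>. (\<lambda>i \<omega>. \<omega> (Suc k) i mod m) (driven_path m \<omega> k) \<omega>) \<in> ?B \<rightarrow>\<^sub>M count_space {..<m}"
      by (rule measurable_compose_countable'[OF app Suc]) auto
    then show ?case by simp
  qed
qed

text \<open>For a prescribed word the events that the successive random maps make the prescribed moves are
  independent, so the probability of a cylinder is the product of the transition probabilities.\<close>
lemma ex_markov_measure:
  assumes \<pi>: "\<pi> \<in> carrier_vec m" "prob_vec \<pi>" and P: "stochastic_mat m P"
  shows "\<exists>\<mu>. markov_measure m \<pi> P \<mu>"
proof -
  define T where "T = (\<lambda>i j. if i < m then P $$ (i, j) else \<pi> $ j)"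
  have m: "m > 0" using \<pi> by (cases "m = 0") (auto simp: prob_vec_def)
  have T: "(\<forall>j<m. 0 \<le> T i j) \<and> (\<Sum>j<m. T i j) = 1" if "i \<le> m" for i
  proof (cases "i < m")
    case True
    then have "prob_vec (row P i)" "dim_vec (row P i) = m" "dim_row P = m" "dim_col P = m"
      using P by (auto simp: stochastic_mat_def)
    then show ?thesis using True by (auto simp: prob_vec_def T_def)
  next
    case False
    then show ?thesis using \<pi> by (auto simp: prob_vec_def T_def)
  qed
  then have "\<forall>i. \<exists>R :: nat pmf. i \<le> m \<longrightarrow> (\<forall>j. pmf R j = (if j < m then T i j else 0))"
    using ex_pmf_of_prob_vec[of m] by blast
  then obtain R :: "nat \<Rightarrow> nat pmf"
    where R: "\<And>i j. i \<le> m \<Longrightarrow> pmf (R i) j = (if j < m then T i j else 0)"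
    by metis
  define F where "F = Pi_pmf {..m} 0 R"
  let ?B = "\<Pi>\<^sub>M n\<in>(UNIV :: nat set). measure_pmf F"
  interpret B: product_prob_space "\<lambda>_. measure_pmf F" "UNIV :: nat set"
    by unfold_locales
  have step: "measure (measure_pmf F) {f. f i mod m = j} = T i j" if "i \<le> m" "j < m" for i j
  proof -
    have "measure (measure_pmf F) {f. f i mod m = j} =
        measure (map_pmf (\<lambda>f. f i) F) {y. y mod m = j}"
      by (simp add: vimage_def)
    also have "map_pmf (\<lambda>f. f i) F = R i"
      using that by (simp add: F_def Pi_pmf_component)
    also have "measure (R i) {y. y mod m = j} = measure (R i) {j}"
    proof (rule measure_eq_AE)
      have "y < m" if "y \<in> set_pmf (R i)" for y
        using that R[OF \<open>i \<le> m\<close>, of y] by (auto simp: set_pmf_eq split: if_splits)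
      then show "AE y in R i. (y \<in> {y. y mod m = j}) = (y \<in> {j})"
        using \<open>j < m\<close> by (auto simp: AE_measure_pmf_iff)
    qed auto
    finally show ?thesis using that by (simp add: measure_pmf_single R)
  qed
  define \<mu> where "\<mu> = distr ?B (seq_space m) (driven_path m)"
  have meas: "driven_path m \<in> ?B \<rightarrow>\<^sub>M seq_space m"
    unfolding seq_space_def
    by (rule measurable_PiM_single'[where f = "\<lambda>k \<omega>. driven_path m \<omega> k"])
      (use measurable_driven_path[OF m, of _ F] in \<open>auto simp: measurable_def\<close>)
  have "measure \<mu> (cylinder m w) = \<pi> $ (w ! 0) * (\<Prod>i<length w - 1. P $$ (w ! i, w ! Suc i))"
    if w: "w \<in> lists {..<m}" "w \<noteq> []" for w
  proof -
    obtain l where l: "length w = Suc l" using w by (cases w) auto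
    define pre where "pre = (\<lambda>i. if i = 0 then m else w ! (i - 1))"
    define E where "E = (\<lambda>i. {f :: nat \<Rightarrow> nat. f (pre i) mod m = w ! i})"
    have wm: "w ! i < m" if "i < length w" for i using w that by (auto simp: lists_eq_set dest: nth_mem)
    \<comment> \<open>On the cylinder the position of the chain before each step is known, so that the
       step at time \<open>i\<close> is a condition on the \<open>i\<close>-th random map alone.\<close>
    have follow: "(\<forall>i<k. driven_path m \<omega> i = w ! i) \<longleftrightarrow> (\<forall>i<k. \<omega> i \<in> E i)" for \<omega> k
    proof (induction k)
      case (Suc k)
      have "driven_path m \<omega> k = w ! k \<longleftrightarrow> \<omega> k \<in> E k" if "\<forall>i<k. driven_path m \<omega> i = w ! i"
        using that by (cases k) (auto simp: E_def pre_def)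
      with Suc show ?case by (auto simp: less_Suc_eq)
    qed simp
    have "measure \<mu> (cylinder m w) = measure ?B (driven_path m -` cylinder m w \<inter> space ?B)"
      unfolding \<mu>_def by (rule measure_distr[OF meas]) simp
    also have "driven_path m -` cylinder m w \<inter> space ?B =
        prod_emb UNIV (\<lambda>_. measure_pmf F) {..<length w} (Pi\<^sub>E {..<length w} E)"
      using follow[of "length w"] measurable_space[OF meas]
      by (auto simp: cylinder_def prod_emb_def space_PiM PiE_def Pi_def extensional_def)
    also have "measure ?B \<dots> = (\<Prod>i<length w. measure (measure_pmf F) (E i))"
      by (rule B.measure_PiM_emb) auto
    also have "\<dots> = (\<Prod>i<length w. T (pre i) (w ! i))"
      using wm by (intro prod.cong refl) (auto simp: E_def pre_def intro!: step less_imp_le)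
    also have "\<dots> = \<pi> $ (w ! 0) * (\<Prod>i<l. P $$ (w ! i, w ! Suc i))"
      using wm l unfolding l prod.lessThan_Suc_shift by (auto simp: pre_def T_def intro!: prod.cong)
    finally show ?thesis using l by simp
  qed
  moreover have "prob_space \<mu>"
    unfolding \<mu>_def by (rule B.prob_space_distr[OF meas])
  ultimately have "markov_measure m \<pi> P \<mu>"
    using assms by (auto simp: markov_measure_def cylinder_measure_def \<mu>_def)
  then show ?thesis by blast
qed

section \<open>Hidden Markov measures from stochastic families of matrices\<close>

text \<open>This is the column vector \<open>N(\<epsilon>\<^sub>1) ... N(\<epsilon>\<^sub>k) v\<close> for the word \<open>\<epsilon>\<^sub>1 ... \<epsilon>\<^sub>k\<close>. Matrices are kept as functions
  of their indices, so that no carrier conditions arise; only indices below \<open>n\<close> are summed over.\<close>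
primrec word_act :: "nat \<Rightarrow> (nat \<Rightarrow> nat \<Rightarrow> nat \<Rightarrow> real) \<Rightarrow> nat list \<Rightarrow> (nat \<Rightarrow> real) \<Rightarrow> nat \<Rightarrow> real" where
  "word_act n N [] v = v"
| "word_act n N (j # w) v = (\<lambda>q. \<Sum>r<n. N j q r * word_act n N w v r)"

lemma word_act_append: "word_act n N (u @ w) v = word_act n N u (word_act n N w v)"
  by (induction u) auto

text \<open>The transpose of a product is the product of the transposes in the opposite order.\<close>
lemma word_act_transpose:
  "(\<Sum>q<n. x q * word_act n N w y q) =
    (\<Sum>q<n. word_act n (\<lambda>j q r. N j r q) (rev w) x q * y q)"
proof (induction w arbitrary: x)
  case (Cons j w)
  have "(\<Sum>q<n. x q * word_act n N (j # w) y q) =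
      (\<Sum>q<n. \<Sum>r<n. x q * N j q r * word_act n N w y r)"
    by (simp add: sum_distrib_left mult.assoc)
  also have "\<dots> = (\<Sum>r<n. (\<Sum>q<n. N j q r * x q) * word_act n N w y r)"
    by (subst sum.swap) (simp add: sum_distrib_left sum_distrib_right mult_ac)
  also have "\<dots> = (\<Sum>q<n. word_act n (\<lambda>j q r. N j r q) (rev w)
      (word_act n (\<lambda>j q r. N j r q) [j] x) q * y q)"
    by (subst Cons.IH) simp
  finally show ?case by (simp add: word_act_append)
qed simp

text \<open>Conjugation by the diagonal matrix of \<open>v\<close> telescopes in a product, and turns \<open>v\<close> into the
  constant vector 1.\<close>
lemma word_act_scale:
  assumes v: "\<And>q. q < n \<Longrightarrow> v q \<noteq> 0" and "q < n"
  shows "word_act n (\<lambda>j q r. N j q r * v r / v q) w (\<lambda>_. 1) q = word_act n N w v q / v q"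
  using assms(2)
proof (induction w arbitrary: q)
  case (Cons j w)
  have "word_act n (\<lambda>j q r. N j q r * v r / v q) (j # w) (\<lambda>_. 1) q =
      (\<Sum>r<n. N j q r * v r / v q * (word_act n N w v r / v r))"
    using Cons.IH by simp
  also have "\<dots> = (\<Sum>r<n. N j q r * word_act n N w v r / v q)"
    using v by (intro sum.cong) auto
  finally show ?case by (simp add: sum_divide_distrib)
qed (use v in auto)

text \<open>A state of the chain is a pair of a letter \<open>\<epsilon> < b\<close> and an index \<open>r < n\<close>, coded as \<open>\<epsilon> * n + r\<close>, so
  that the letter is recovered by division by \<open>n\<close>.\<close>
lemma block_letter:
  fixes \<epsilon> r n b :: nat
  assumes "\<epsilon> < b" "r < n" shows "\<epsilon> * n + r < n * b" "(\<epsilon> * n + r) div n = \<epsilon>" "(\<epsilon> * n + r) mod n = r"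
proof -
  have "\<epsilon> * n + r < Suc \<epsilon> * n" using assms by simp
  also have "\<dots> \<le> b * n" using assms by (intro mult_right_mono) auto
  finally show "\<epsilon> * n + r < n * b" by (simp add: mult.commute)
qed (use assms in auto)

lemma sum_block_states:
  "(\<Sum>i<n * b. f i) = (\<Sum>\<epsilon><b. \<Sum>r<n. f (\<epsilon> * n + r :: nat))"
proof -
  have "(\<Sum>i<n * b. f i) = (\<Sum>\<epsilon><b. sum f {\<epsilon> * n..<\<epsilon> * n + n})"
    by (simp add: sum.nat_group mult.commute)
  moreover have "sum f {\<epsilon> * n..<\<epsilon> * n + n} = (\<Sum>r<n. f (\<epsilon> * n + r))" for \<epsilon>
    by (rule sum.reindex_bij_witness[of _ "\<lambda>r. \<epsilon> * n + r" "\<lambda>i. i - \<epsilon> * n"]) auto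
  ultimately show ?thesis by simp
qed

text \<open>The chain is observed after its first move: before it the index is drawn from \<open>c\<close>, and the
  first state records the letter emitted by that move together with the new index.\<close>
definition block_init :: "nat \<Rightarrow> nat \<Rightarrow> (nat \<Rightarrow> real) \<Rightarrow> (nat \<Rightarrow> nat \<Rightarrow> nat \<Rightarrow> real) \<Rightarrow> real vec" where
  "block_init n b c N = vec (n * b) (\<lambda>i. \<Sum>q<n. c q * N (i div n) q (i mod n))"

definition block_trans :: "nat \<Rightarrow> nat \<Rightarrow> (nat \<Rightarrow> nat \<Rightarrow> nat \<Rightarrow> real) \<Rightarrow> real mat" where
  "block_trans n b N = mat (n * b) (n * b) (\<lambda>(i, j). N (j div n) (i mod n) (j mod n))"

lemma block_trans_block:
  assumes "i < n * b" "\<epsilon> < b" "r < n"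
  shows "block_trans n b N $$ (i, \<epsilon> * n + r) = N \<epsilon> (i mod n) r"
  using assms by (simp add: block_trans_def block_letter)

lemma block_init_block:
  assumes "\<epsilon> < b" "r < n"
  shows "block_init n b c N $ (\<epsilon> * n + r) = (\<Sum>q<n. c q * N \<epsilon> q r)"
  using assms by (simp add: block_init_def block_letter)

lemma sum_lifted_words:
  fixes n b \<epsilon> :: nat
  assumes "set (\<epsilon> # w) \<subseteq> {..<b}"
  shows "(\<Sum>u | set u \<subseteq> {..<n * b} \<and> map (\<lambda>i. i div n) u = \<epsilon> # w. f u) =
    (\<Sum>r<n. \<Sum>u | set u \<subseteq> {..<n * b} \<and> map (\<lambda>i. i div n) u = w. f ((\<epsilon> * n + r) # u))"
proof -
  let ?U = "{u. set u \<subseteq> {..<n * b} \<and> map (\<lambda>i. i div n) u = w}"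
  have pos: "n > 0" if "z < n * b" for z using that by (cases n) auto
  have "(\<Sum>r<n. \<Sum>u\<in>?U. f ((\<epsilon> * n + r) # u)) =
      (\<Sum>(r, u)\<in>{..<n} \<times> ?U. f ((\<epsilon> * n + r) # u))"
    by (rule sum.cartesian_product)
  also have "\<dots> = (\<Sum>u | set u \<subseteq> {..<n * b} \<and> map (\<lambda>i. i div n) u = \<epsilon> # w. f u)"
    using assms
    by (intro sum.reindex_bij_witness[of _ "\<lambda>u. (hd u mod n, tl u)" "\<lambda>(r, u). (\<epsilon> * n + r) # u"])
      (auto simp: block_letter Cons_eq_map_conv intro!: mod_less_divisor dest: pos)
  finally show ?thesis by simp
qed

text \<open>Given the current state, the probability to emit \<open>w\<close> in the following moves depends only on the
  index part of that state, which is why the letter part can be forgotten.\<close>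
lemma sum_paths_over_word:
  assumes "set w \<subseteq> {..<b}" "i < n * b"
  shows "(\<Sum>u | set u \<subseteq> {..<n * b} \<and> map (\<lambda>i. i div n) u = w.
      \<Prod>k<length w. block_trans n b N $$ ((i # u) ! k, u ! k)) = word_act n N w (\<lambda>_. 1) (i mod n)"
  using assms
proof (induction w arbitrary: i)
  case Nil
  have "{u. set u \<subseteq> {..<n * b} \<and> u = []} = {[]}" by auto
  then show ?case by simp
next
  case (Cons \<epsilon> w)
  have "(\<Sum>u | set u \<subseteq> {..<n * b} \<and> map (\<lambda>i. i div n) u = \<epsilon> # w.
      \<Prod>k<length (\<epsilon> # w). block_trans n b N $$ ((i # u) ! k, u ! k)) =
    (\<Sum>r<n. block_trans n b N $$ (i, \<epsilon> * n + r) *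
      (\<Sum>u | set u \<subseteq> {..<n * b} \<and> map (\<lambda>i. i div n) u = w.
        \<Prod>k<length w. block_trans n b N $$ (((\<epsilon> * n + r) # u) ! k, u ! k)))"
    using Cons.prems unfolding sum_lifted_words[OF Cons.prems(1)]
    by (simp add: prod.lessThan_Suc_shift sum_distrib_left del: prod.lessThan_Suc)
  also have "\<dots> = (\<Sum>r<n. N \<epsilon> (i mod n) r * word_act n N w (\<lambda>_. 1) r)"
    using Cons.prems by (intro sum.cong refl) (simp add: block_trans_block block_letter Cons.IH)
  finally show ?case by simp
qed

lemma block_letters_measurable:
  "(\<lambda>\<omega> k. \<omega> k div n) \<in> seq_space (n * b) \<rightarrow>\<^sub>M seq_space b"
proof -
  have "(\<lambda>i. i div n) \<in> count_space {..<n * b} \<rightarrow>\<^sub>M count_space {..<b}"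
    by (auto simp: less_mult_imp_div_less mult.commute)
  then have "(\<lambda>\<omega>. \<omega> k div n) \<in> seq_space (n * b) \<rightarrow>\<^sub>M count_space {..<b}" for k
    unfolding seq_space_def
    by (rule measurable_compose[OF measurable_component_singleton, rotated]) simp
  then show ?thesis
    unfolding seq_space_def[of b]
    by (intro measurable_PiM_single')
      (auto simp: space_seq_space PiE_def Pi_def less_mult_imp_div_less mult.commute)
qed

text \<open>Summing the probabilities of all paths of states above a given word amounts to multiplying the
  matrices of its letters.\<close>
theorem block_chain:
  fixes N :: "nat \<Rightarrow> nat \<Rightarrow> nat \<Rightarrow> real" and c :: "nat \<Rightarrow> real"
  assumes N0: "\<And>j q r. j < b \<Longrightarrow> q < n \<Longrightarrow> r < n \<Longrightarrow> 0 \<le> N j q r"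
    and N1: "\<And>q. q < n \<Longrightarrow> (\<Sum>j<b. \<Sum>r<n. N j q r) = 1"
    and c0: "\<And>q. q < n \<Longrightarrow> 0 \<le> c q" and c1: "(\<Sum>q<n. c q) = 1"
  shows "\<exists>\<mu>. markov_measure (n * b) (block_init n b c N) (block_trans n b N) \<mu> \<and>
    cylinder_measure b (\<lambda>w. \<Sum>q<n. c q * word_act n N w (\<lambda>_. 1) q)
      (distr \<mu> (seq_space b) (\<lambda>\<omega> k. \<omega> k div n))"
proof -
  have n: "n > 0" using c1 by (cases n) auto
  have blk: "i div n < b" "i mod n < n" if "i < n * b" for i
    using that n by (auto simp: less_mult_imp_div_less mult.commute)
  have "(\<Sum>i<n * b. \<Sum>q<n. c q * N (i div n) q (i mod n)) =
      (\<Sum>j<b. \<Sum>r<n. \<Sum>q<n. c q * N j q r)"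
    unfolding sum_block_states by (simp add: block_letter)
  also have "\<dots> = (\<Sum>j<b. \<Sum>q<n. \<Sum>r<n. c q * N j q r)"
    by (intro sum.cong refl sum.swap)
  also have "\<dots> = (\<Sum>q<n. \<Sum>j<b. \<Sum>r<n. c q * N j q r)"
    by (rule sum.swap)
  also have "\<dots> = (\<Sum>q<n. c q * (\<Sum>j<b. \<Sum>r<n. N j q r))"
    by (simp add: sum_distrib_left)
  finally have init1: "(\<Sum>i<n * b. \<Sum>q<n. c q * N (i div n) q (i mod n)) = 1"
    using N1 c1 by simp
  have init: "prob_vec (block_init n b c N)"
    unfolding prob_vec_def block_init_def
    using blk init1 by (auto intro!: sum_nonneg mult_nonneg_nonneg N0 c0)
  have "stochastic_mat (n * b) (block_trans n b N)"
    unfolding stochastic_mat_def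
  proof (intro conjI allI impI)
    fix i assume i: "i < n * b"
    have "(\<Sum>j<n * b. N (j div n) (i mod n) (j mod n)) = 1"
      unfolding sum_block_states using N1[of "i mod n"] n by (simp add: block_letter)
    then show "prob_vec (row (block_trans n b N) i)"
      using i blk by (auto simp: prob_vec_def block_trans_def N0)
  qed (simp add: block_trans_def)
  then obtain \<mu> where \<mu>: "markov_measure (n * b) (block_init n b c N) (block_trans n b N) \<mu>"
    using ex_markov_measure[of "block_init n b c N" "n * b"] init by (auto simp: block_init_def)
  then have cyl: "cylinder_measure (n * b) (\<lambda>w. block_init n b c N $ (w ! 0) *
      (\<Prod>i<length w - 1. block_trans n b N $$ (w ! i, w ! Suc i))) \<mu>"
    by (simp add: markov_measure_def)
  then interpret prob_space \<mu> by (simp add: cylinder_measure_def)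
  have sets: "sets \<mu> = sets (seq_space (n * b))" using cyl by (simp add: cylinder_measure_def)
  let ?\<phi> = "\<lambda>\<omega> k. \<omega> k div n :: nat"
  have meas: "?\<phi> \<in> \<mu> \<rightarrow>\<^sub>M seq_space b"
    using block_letters_measurable by (simp cong: measurable_cong_sets add: sets)
  have "measure (distr \<mu> (seq_space b) ?\<phi>) (cylinder b w) = (\<Sum>q<n. c q * word_act n N w (\<lambda>_. 1) q)"
    if w: "w \<in> lists {..<b}" "w \<noteq> []" for w
  proof -
    obtain \<epsilon> w' where w': "w = \<epsilon> # w'" using w by (cases w) auto
    have wb: "set (\<epsilon> # w') \<subseteq> {..<b}" using w w' by auto
    let ?path = "\<lambda>i u. \<Prod>k<length w'. block_trans n b N $$ ((i # u) ! k, u ! k)"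
    have "measure (distr \<mu> (seq_space b) ?\<phi>) (cylinder b w) =
        measure \<mu> (?\<phi> -` cylinder b w \<inter> space \<mu>)"
      by (rule measure_distr[OF meas]) simp
    also have "?\<phi> -` cylinder b w \<inter> space \<mu> =
        {\<omega> \<in> space (seq_space (n * b)). map (\<lambda>i. i div n) (map \<omega> [0..<length w]) = w}"
      using measurable_space[OF meas]
      by (auto simp: cylinder_conv_prefix sets_eq_imp_space_eq[OF sets] comp_def)
    also have "measure \<mu> \<dots> = (\<Sum>u | set u \<subseteq> {..<n * b} \<and> length u = length w \<and>
        map (\<lambda>i. i div n) u = w. measure \<mu> (cylinder (n * b) u))"
      by (rule measure_prefix_event[OF _ sets]) unfold_locales
    also have "\<dots> = (\<Sum>u | set u \<subseteq> {..<n * b} \<and> map (\<lambda>i. i div n) u = \<epsilon> # w'.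
        block_init n b c N $ (u ! 0) * (\<Prod>i<length u - 1. block_trans n b N $$ (u ! i, u ! Suc i)))"
      using cyl unfolding w' by (intro sum.cong) (auto simp: cylinder_measure_def dest: arg_cong[of _ _ length])
    also have "\<dots> = (\<Sum>r<n. block_init n b c N $ (\<epsilon> * n + r) *
        (\<Sum>u | set u \<subseteq> {..<n * b} \<and> map (\<lambda>i. i div n) u = w'. ?path (\<epsilon> * n + r) u))"
      unfolding sum_lifted_words[OF wb] sum_distrib_left by (intro sum.cong refl) auto
    also have "\<dots> = (\<Sum>r<n. \<Sum>q<n. c q * (N \<epsilon> q r * word_act n N w' (\<lambda>_. 1) r))"
      using wb by (intro sum.cong refl)
        (simp add: sum_paths_over_word block_letter block_init_block sum_distrib_right mult.assoc)
    also have "\<dots> = (\<Sum>q<n. c q * word_act n N w (\<lambda>_. 1) q)"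
      by (subst sum.swap) (simp add: w' sum_distrib_left)
    finally show ?thesis .
  qed
  then have "cylinder_measure b (\<lambda>w. \<Sum>q<n. c q * word_act n N w (\<lambda>_. 1) q)
      (distr \<mu> (seq_space b) ?\<phi>)"
    by (auto simp: cylinder_measure_def intro: prob_space_distr[OF meas])
  with \<mu> show ?thesis by blast
qed

lemma sofic_block_image:
  assumes "markov_measure (n * b) \<pi> P \<mu>"
  shows "sofic b (distr \<mu> (seq_space b) (\<lambda>\<omega> k. \<omega> k div n))"
  unfolding sofic_def
proof (intro exI conjI)
  show "continuous_on (space (seq_space (n * b))) (\<lambda>\<omega> k. \<omega> k div n)"
  proof (rule continuous_on_coordinatewise_then_product)
    fix k :: nat
    have proj: "continuous_on (space (seq_space (n * b))) (\<lambda>\<omega> :: nat \<Rightarrow> nat. \<omega> k)"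
      by (rule continuous_on_subset[OF continuous_on_product_coordinates]) simp
    have "continuous_on UNIV (\<lambda>i. i div n)" by simp
    from continuous_on_compose2[OF this proj] show "continuous_on (space (seq_space (n * b))) (\<lambda>\<omega> :: nat \<Rightarrow> nat. \<omega> k div n)"
      by simp
  qed
  show "(\<lambda>\<omega> k. \<omega> k div n) \<in> space (seq_space (n * b)) \<rightarrow> space (seq_space b)"
    using measurable_space[OF block_letters_measurable] by blast
qed (use assms in \<open>auto simp: shift_def\<close>)

section \<open>Self-similarity of the Bernoulli convolution\<close>

text \<open>The summation variable changes from the digit \<open>s\<close> to the translate \<open>r = t - s\<close>. The digits
  form one window, the translates that carry mass another one, and outside either window the summand
  is zero.\<close>
lemma sum_reindex_window:
  fixes p :: "nat \<Rightarrow> real" and g :: "int \<Rightarrow> real"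
  assumes "\<And>r. r < 0 \<or> int n \<le> r \<Longrightarrow> g r = 0"
  shows "(\<Sum>s<d. p s * g (t - int s)) = (\<Sum>r<n. p_ext d p (t - int r) * g (int r))"
proof -
  have "(\<Sum>s<d. p s * g (t - int s)) = (\<Sum>r\<in>(\<lambda>s. t - int s) ` {..<d}. p_ext d p (t - r) * g r)"
    by (subst sum.reindex) (auto simp: inj_on_def p_ext_def)
  also have "\<dots> = (\<Sum>r\<in>(\<lambda>s. t - int s) ` {..<d} \<union> int ` {..<n}. p_ext d p (t - r) * g r)"
  proof (rule sum.mono_neutral_left)
    show "\<forall>r\<in>(\<lambda>s. t - int s) ` {..<d} \<union> int ` {..<n} - (\<lambda>s. t - int s) ` {..<d}.
        p_ext d p (t - r) * g r = 0"
    proof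
      fix r assume r: "r \<in> (\<lambda>s. t - int s) ` {..<d} \<union> int ` {..<n} - (\<lambda>s. t - int s) ` {..<d}"
      have "\<not> (0 \<le> t - r \<and> t - r < int d)"
      proof
        assume "0 \<le> t - r \<and> t - r < int d"
        then have "r = t - int (nat (t - r))" "nat (t - r) \<in> {..<d}" by auto
        with r show False by blast
      qed
      then show "p_ext d p (t - r) * g r = 0" by (auto simp: p_ext_def)
    qed
  qed auto
  also have "\<dots> = (\<Sum>r\<in>int ` {..<n}. p_ext d p (t - r) * g r)"
  proof (rule sum.mono_neutral_right)
    show "\<forall>r\<in>(\<lambda>s. t - int s) ` {..<d} \<union> int ` {..<n} - int ` {..<n}. p_ext d p (t - r) * g r = 0"
    proof
      fix r assume r: "r \<in> (\<lambda>s. t - int s) ` {..<d} \<union> int ` {..<n} - int ` {..<n}"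
      have "r < 0 \<or> int n \<le> r"
      proof (rule ccontr)
        assume "\<not> ?thesis"
        then have "r = int (nat r)" "nat r \<in> {..<n}" by auto
        with r show False by blast
      qed
      then show "p_ext d p (t - r) * g r = 0" by (simp add: assms)
    qed
  qed auto
  also have "\<dots> = (\<Sum>r<n. p_ext d p (t - int r) * g (int r))"
    by (subst sum.reindex) auto
  finally show ?thesis .
qed

definition digit_sum :: "nat \<Rightarrow> (nat \<Rightarrow> nat) \<Rightarrow> real" where
  "digit_sum b \<omega> = (\<Sum>k. real (\<omega> k) / real b ^ Suc k)"

definition word_value :: "nat \<Rightarrow> nat list \<Rightarrow> real" where
  "word_value b w = (\<Sum>i<length w. real (w ! i) / real b ^ Suc i)"

lemma word_value_Cons: "word_value b (\<epsilon> # w) = (real \<epsilon> + word_value b w) / real b"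
  unfolding word_value_def list.size add_Suc_right add_0_right sum.lessThan_Suc_shift
  by (simp add: sum_divide_distrib add_divide_distrib mult.commute)

text \<open>Translates by negative integers are needed as well: they occur when the first digit is removed,
  before being discarded because they carry no mass.\<close>
definition cell :: "nat \<Rightarrow> int \<Rightarrow> nat list \<Rightarrow> real set" where
  "cell b q w = {of_int q + word_value b w ..< of_int q + word_value b w + 1 / real b ^ length w}"

lemma translate_word_interval: "(\<lambda>x. real q + x) ` word_interval b w = cell b (int q) w"
  unfolding word_interval_def Let_def cell_def word_value_def by (simp add: ac_simps)

lemma cell_Nil: "cell b q [] = {of_int q ..< of_int q + 1}"
  by (simp add: cell_def word_value_def)

lemma word_value_bounds:
  assumes "b > 0" "set w \<subseteq> {..<b}"
  shows "0 \<le> word_value b w \<and> word_value b w + 1 / real b ^ length w \<le> 1"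
  using assms(2)
proof (induction w)
  case Nil
  then show ?case by (simp add: word_value_def)
next
  case (Cons \<epsilon> w)
  have "real \<epsilon> + 1 \<le> real b" using Cons.prems by (auto simp: less_eq_real_def)
  moreover have "word_value b w + 1 / real b ^ length w \<le> 1" "0 \<le> word_value b w" using Cons by auto
  moreover have "word_value b (\<epsilon> # w) + 1 / real b ^ length (\<epsilon> # w) =
      (real \<epsilon> + (word_value b w + 1 / real b ^ length w)) / real b"
    by (simp add: word_value_Cons add_divide_distrib mult.commute)
  ultimately show ?case using assms(1) by (simp add: word_value_Cons)
qed

lemma cell_subset_unit:
  assumes "b > 0" "set w \<subseteq> {..<b}"
  shows "cell b q w \<subseteq> cell b q []"
  using word_value_bounds[OF assms] by (auto simp: cell_def word_value_def)

lemma vimage_cell_Cons: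
  assumes "b > 0"
  shows "(\<lambda>x. (real s + x) / real b) -` cell b q (\<epsilon> # w) = cell b (int b * q + int \<epsilon> - int s) w"
proof -
  have "(real s + x) / real b \<in> cell b q (\<epsilon> # w) \<longleftrightarrow> x \<in> cell b (int b * q + int \<epsilon> - int s) w" for x
  proof -
    have "of_int q + word_value b (\<epsilon> # w) = (real b * of_int q + real \<epsilon> + word_value b w) / real b"
      using assms by (simp add: word_value_Cons field_simps)
    moreover have "of_int q + word_value b (\<epsilon> # w) + 1 / real b ^ length (\<epsilon> # w) =
        (real b * of_int q + real \<epsilon> + word_value b w + 1 / real b ^ length w) / real b"
      using assms by (simp add: word_value_Cons field_simps)
    ultimately show ?thesis
      using assms unfolding cell_def by (auto simp: divide_le_cancel divide_less_cancel)
  qed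
  then show ?thesis by auto
qed

locale bernoulli_digits =
  fixes b d :: nat and p :: "nat \<Rightarrow> real"
  assumes b2: "2 \<le> b" and bd: "b \<le> d"
    and p_pos: "\<And>i. i < d \<Longrightarrow> 0 < p i" and p_sum: "(\<Sum>i<d. p i) = 1"
begin

abbreviation digit_law :: "nat measure" where
  "digit_law \<equiv> point_measure {..<d} (\<lambda>i. ennreal (p i))"

abbreviation digit_space :: "(nat \<Rightarrow> nat) measure" where
  "digit_space \<equiv> \<Pi>\<^sub>M k\<in>(UNIV :: nat set). digit_law"

abbreviation \<eta> :: "real measure" where
  "\<eta> \<equiv> bernoulli_conv b d p"

text \<open>The value of the sum when every digit is \<open>d - 1\<close>.\<close>
definition max_sum :: real where
  "max_sum = (real d - 1) / (real b - 1)"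

text \<open>The number of unit intervals \<open>[q, q + 1)\<close> that carry mass, and the size of the matrices.\<close>
definition n :: nat where
  "n = a_of b d + 1"

lemma prob_space_digit_law: "prob_space digit_law"
proof
  have "emeasure digit_law {..<d} = (\<Sum>i<d. ennreal (p i))"
    by (simp add: emeasure_point_measure_finite)
  also have "\<dots> = 1"
    using p_pos p_sum by (subst sum_ennreal) (auto simp: less_imp_le)
  finally show "emeasure digit_law (space digit_law) = 1"
    by (simp add: space_point_measure)
qed

sublocale digits: sequence_space digit_law
  using prob_space_digit_law
  by (simp add: sequence_space_def product_prob_space_def product_prob_space_axioms_def
      product_sigma_finite_def prob_space_imp_sigma_finite)

lemma space_digit_space: "space digit_space = {\<omega>. \<forall>k. \<omega> k < d}"
  by (auto simp: space_PiM space_point_measure PiE_def Pi_def)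

lemma \<eta>_eq: "\<eta> = distr digit_space borel (digit_sum b)"
  by (simp add: bernoulli_conv_def digit_sum_def[abs_def])

lemma measurable_digit_sum [measurable]: "digit_sum b \<in> digit_space \<rightarrow>\<^sub>M borel"
proof -
  have "(\<lambda>\<omega>. real (\<omega> k) / real b ^ Suc k) \<in> digit_space \<rightarrow>\<^sub>M borel" for k
    by (rule measurable_compose[OF measurable_component_singleton]) auto
  then show ?thesis
    unfolding digit_sum_def[abs_def] by (rule borel_measurable_suminf)
qed

lemma sets_\<eta> [simp, measurable_cong]: "sets \<eta> = sets borel"
  and space_\<eta> [simp]: "space \<eta> = UNIV"
  by (simp_all add: \<eta>_eq)

sublocale \<eta>: prob_space \<eta>
  unfolding \<eta>_eq by (rule digits.P.prob_space_distr) (rule measurable_digit_sum)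

lemma geometric_max_sum: "(\<lambda>k. (real d - 1) / real b ^ Suc k) sums max_sum"
proof -
  have "(\<lambda>k. (1 / real b) ^ k) sums (1 / (1 - 1 / real b))"
    using b2 by (intro geometric_sums) simp
  then have "(\<lambda>k. (real d - 1) / real b * (1 / real b) ^ k) sums
      ((real d - 1) / real b * (1 / (1 - 1 / real b)))"
    by (rule sums_mult)
  moreover have "(real d - 1) / real b * (1 / (1 - 1 / real b)) = max_sum"
    using b2 by (simp add: max_sum_def field_simps)
  ultimately show ?thesis by (simp add: power_divide)
qed

lemma summable_digits:
  assumes "\<And>k. \<omega> k < d"
  shows "summable (\<lambda>k. real (\<omega> k) / real b ^ Suc k)"
proof (rule summable_comparison_test'[OF sums_summable[OF geometric_max_sum], of 0])
  fix k
  have "real (\<omega> k) \<le> real d - 1" using assms[of k] by linarith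
  then show "norm (real (\<omega> k) / real b ^ Suc k) \<le> (real d - 1) / real b ^ Suc k"
    by (simp add: divide_right_mono)
qed

lemma digit_sum_bounds:
  assumes "\<And>k. \<omega> k < d"
  shows "0 \<le> digit_sum b \<omega>" "digit_sum b \<omega> \<le> max_sum"
proof -
  show "0 \<le> digit_sum b \<omega>"
    unfolding digit_sum_def by (rule suminf_nonneg[OF summable_digits[of \<omega>]]) (use assms in auto)
  have le: "real (\<omega> k) / real b ^ Suc k \<le> (real d - 1) / real b ^ Suc k" for k
  proof -
    have "real (\<omega> k) \<le> real d - 1" using assms[of k] by linarith
    then show ?thesis by (simp add: divide_right_mono)
  qed
  show "digit_sum b \<omega> \<le> max_sum"
    unfolding digit_sum_def sums_unique[OF geometric_max_sum]
    by (rule suminf_le[OF le summable_digits[of \<omega>] sums_summable[OF geometric_max_sum]]) (use assms in auto)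
qed

lemma digit_sum_case_nat:
  assumes "s < d" "\<And>k. \<omega> k < d"
  shows "digit_sum b (case_nat s \<omega>) = (real s + digit_sum b \<omega>) / real b"
proof -
  let ?f = "\<lambda>k. real (case_nat s \<omega> k) / real b ^ Suc k"
  have "summable ?f"
    by (rule summable_digits) (use assms in \<open>auto split: nat.split\<close>)
  then have "suminf ?f = ?f 0 + (\<Sum>k. ?f (Suc k))"
    using suminf_split_head[of ?f] by linarith
  also have "(\<Sum>k. ?f (Suc k)) = (\<Sum>k. real (\<omega> k) / real b ^ Suc k / real b)"
    by (simp add: mult.commute)
  also have "\<dots> = (\<Sum>k. real (\<omega> k) / real b ^ Suc k) / real b"
    using summable_digits[of \<omega>] assms by (intro suminf_divide) auto
  finally show ?thesis
    by (simp add: digit_sum_def add_divide_distrib)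
qed

text \<open>A sequence of independent digits is a first digit followed by an independent sequence with the
  same law.\<close>
lemma self_similar:
  assumes A: "A \<in> sets borel"
  shows "\<eta>.prob A = (\<Sum>s<d. p s * \<eta>.prob ((\<lambda>x. (real s + x) / real b) -` A))"
proof -
  interpret D: prob_space digit_law by (rule prob_space_digit_law)
  let ?cons = "\<lambda>(s, \<omega>). case_nat s \<omega> :: nat \<Rightarrow> nat"
  let ?E = "digit_sum b -` A \<inter> space digit_space"
  have E: "?E \<in> sets digit_space" using A by (intro measurable_sets[OF measurable_digit_sum])
  have cons: "?cons \<in> digit_law \<Otimes>\<^sub>M digit_space \<rightarrow>\<^sub>M digit_space"
    by measurable
  have fibre: "Pair s -` (?cons -` ?E \<inter> space (digit_law \<Otimes>\<^sub>M digit_space)) =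
      digit_sum b -` ((\<lambda>x. (real s + x) / real b) -` A) \<inter> space digit_space" if "s < d" for s
    using that
    by (auto simp: space_pair_measure space_digit_space space_point_measure digit_sum_case_nat
        split: nat.split)
  have vA: "(\<lambda>x. (real s + x) / real b) -` A \<in> sets borel" for s
    using measurable_sets[of "\<lambda>x. (real s + x) / real b" borel borel A] A by simp
  have "emeasure \<eta> A = emeasure digit_space ?E"
    unfolding \<eta>_eq using A by (simp add: emeasure_distr)
  also have "\<dots> = emeasure (distr (digit_law \<Otimes>\<^sub>M digit_space) digit_space ?cons) ?E"
    by (simp add: digits.PiM_iter)
  also have "\<dots> = emeasure (digit_law \<Otimes>\<^sub>M digit_space)
      (?cons -` ?E \<inter> space (digit_law \<Otimes>\<^sub>M digit_space))"
    by (rule emeasure_distr[OF cons E])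
  also have "\<dots> = (\<integral>\<^sup>+s. emeasure digit_space
      (Pair s -` (?cons -` ?E \<inter> space (digit_law \<Otimes>\<^sub>M digit_space))) \<partial>digit_law)"
    by (rule digits.P.emeasure_pair_measure_alt) (rule measurable_sets[OF cons E])
  also have "\<dots> = (\<Sum>s<d. ennreal (p s) * emeasure \<eta> ((\<lambda>x. (real s + x) / real b) -` A))"
    unfolding nn_integral_point_measure_finite[OF finite_lessThan]
  proof (intro sum.cong refl)
    fix s assume "s \<in> {..<d}"
    then have s: "s < d" by simp
    show "ennreal (p s) * emeasure digit_space
        (Pair s -` (?cons -` ?E \<inter> space (digit_law \<Otimes>\<^sub>M digit_space))) =
      ennreal (p s) * emeasure \<eta> ((\<lambda>x. (real s + x) / real b) -` A)"
      unfolding fibre[OF s] \<eta>_eq by (simp only: emeasure_distr[OF measurable_digit_sum vA])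
  qed
  also have "\<dots> = ennreal (\<Sum>s<d. p s * \<eta>.prob ((\<lambda>x. (real s + x) / real b) -` A))"
    using p_pos by (subst sum_ennreal[symmetric])
      (auto simp: \<eta>.emeasure_eq_measure ennreal_mult less_imp_le)
  finally show ?thesis
    using p_pos unfolding \<eta>.emeasure_eq_measure
    by (subst (asm) ennreal_inj) (auto intro!: sum_nonneg simp: less_imp_le)
qed

lemma prob_outside_support:
  assumes "A \<in> sets borel" "A \<subseteq> {..<0} \<union> {max_sum<..}"
  shows "\<eta>.prob A = 0"
proof -
  have "digit_sum b -` A \<inter> space digit_space = {}"
  proof (rule ccontr)
    assume "\<not> ?thesis"
    then obtain \<omega> where "\<And>k. \<omega> k < d" "digit_sum b \<omega> \<in> A" by (auto simp: space_digit_space)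
    with digit_sum_bounds[of \<omega>] assms(2) show False by auto
  qed
  then show ?thesis unfolding \<eta>_eq using assms(1) by (simp add: measure_distr)
qed

lemma max_sum_ge_1: "1 \<le> max_sum"
  using b2 bd by (simp add: max_sum_def)

lemma p_less_1: "s < d \<Longrightarrow> p s < 1"
proof -
  assume s: "s < d"
  define t where "t = (if s = 0 then 1 else 0 :: nat)"
  have t: "t < d" "t \<noteq> s" using b2 bd by (auto simp: t_def)
  have "p s + p t = sum p {s, t}" using t by simp
  also have "\<dots> \<le> sum p {..<d}"
    using s t p_pos by (intro sum_mono2) (auto simp: less_imp_le)
  finally show "p s < 1" using p_sum p_pos[OF t(1)] by simp
qed

text \<open>Without its first digit the sum can still reach its maximum only if that digit was \<open>d - 1\<close>. So
  the mass \<open>x\<close> of the end point satisfies \<open>x = p (d - 1) * x\<close>, and \<open>p (d - 1) < 1\<close> because there are at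
  least two digits.\<close>
lemma prob_top_atom: "\<eta>.prob {max_sum..} = 0"
proof -
  have fix_top: "real b * max_sum - (real d - 1) = max_sum"
    using b2 by (simp add: max_sum_def field_simps)
  have vi: "(\<lambda>x. (real s + x) / real b) -` {max_sum..} = {real b * max_sum - real s..}" for s
    using b2 by (auto simp: field_simps)
  have "\<eta>.prob {max_sum..} = (\<Sum>s<d. p s * \<eta>.prob {real b * max_sum - real s..})"
    by (subst self_similar) (auto simp: vi)
  also have "\<dots> = (\<Sum>s<d. if s = d - 1 then p s * \<eta>.prob {max_sum..} else 0)"
  proof (intro sum.cong refl)
    fix s assume s: "s \<in> {..<d}"
    show "p s * \<eta>.prob {real b * max_sum - real s..} = (if s = d - 1 then p s * \<eta>.prob {max_sum..} else 0)"
    proof (cases "s = d - 1")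
      case True
      then have "real b * max_sum - real s = max_sum" using fix_top b2 bd by (simp add: of_nat_diff)
      then show ?thesis using True by simp
    next
      case False
      then have "real s + 1 \<le> real d - 1" using s by (simp add: nat_less_real_le less_diff_conv)
      then have "\<eta>.prob {real b * max_sum - real s..} = 0"
        using fix_top by (intro prob_outside_support) auto
      then show ?thesis using False by simp
    qed
  qed
  also have "\<dots> = p (d - 1) * \<eta>.prob {max_sum..}"
    using b2 bd by simp
  finally have "(1 - p (d - 1)) * \<eta>.prob {max_sum..} = 0" by (simp add: algebra_simps)
  moreover have "p (d - 1) < 1" using b2 bd by (intro p_less_1) auto
  ultimately show ?thesis by simp
qed

lemma real_a_of: "real (a_of b d) < max_sum" "max_sum \<le> real n"
proof -
  have "\<lceil>max_sum\<rceil> \<ge> 1" using max_sum_ge_1 by (simp add: one_le_ceiling)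
  then have "real (a_of b d) = of_int \<lceil>max_sum\<rceil> - 1"
    by (simp add: a_of_def max_sum_def)
  moreover have "of_int \<lceil>max_sum\<rceil> - 1 < max_sum" "max_sum \<le> of_int \<lceil>max_sum\<rceil>"
    by linarith+
  ultimately show "real (a_of b d) < max_sum" "max_sum \<le> real n" by (auto simp: n_def)
qed

lemma n_pos: "n > 0" by (simp add: n_def)

text \<open>The two estimates on \<open>a\<close> that enter the positivity pattern and the column sums of the matrix:
  \<open>(b - 1) a < d - 1\<close>, which for integers gains one more unit, and \<open>d - 1 \<le> (b - 1) (a + 1)\<close>.\<close>
lemma index_bound: "q < n \<Longrightarrow> int b * int q + 2 \<le> int q + int d"
proof -
  assume q: "q < n"
  have "real q < max_sum" using q real_a_of(1) by (auto simp: n_def)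
  then have "real q * (real b - 1) < real d - 1"
    using b2 by (simp add: max_sum_def pos_less_divide_eq)
  then have "real_of_int (int b * int q) < real_of_int (int q + int d - 1)"
    by (simp add: algebra_simps)
  then show ?thesis by linarith
qed

lemma d_bound: "d + n \<le> n * b + 1"
proof -
  have "real d - 1 \<le> real n * (real b - 1)"
    using real_a_of(2) b2 by (simp add: max_sum_def pos_divide_le_eq)
  then have "real (d + n) \<le> real (n * b + 1)" by (simp add: algebra_simps)
  then show ?thesis by linarith
qed

definition mass :: "int \<Rightarrow> nat list \<Rightarrow> real" where
  "mass q w = \<eta>.prob (cell b q w)"

lemma mass_nonneg: "0 \<le> mass q w"
  by (simp add: mass_def)

lemma cell_borel: "cell b q w \<in> sets borel"
  by (simp add: cell_def)

lemma mass_eq_0: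
  assumes "r < 0 \<or> int n \<le> r" "set w \<subseteq> {..<b}"
  shows "mass r w = 0"
proof -
  have sub: "cell b r w \<subseteq> {of_int r ..< of_int r + 1}"
    using cell_subset_unit[of b w r] assms b2 by (simp add: cell_Nil)
  show ?thesis
  proof (cases "r < 0")
    case True
    then have "(of_int r :: real) + 1 \<le> 0" by linarith
    then show ?thesis
      unfolding mass_def using sub by (intro prob_outside_support cell_borel) fastforce
  next
    case False
    then have "max_sum \<le> of_int r" using assms(1) real_a_of(2) by linarith
    then have "cell b r w \<subseteq> {max_sum..}" using sub by fastforce
    then have "mass r w \<le> \<eta>.prob {max_sum..}"
      unfolding mass_def by (intro \<eta>.finite_measure_mono) auto
    then show ?thesis using prob_top_atom mass_nonneg[of r w] by simp
  qed
qed

text \<open>The entry of the matrix \<open>M(j)\<close> in row \<open>q\<close> and column \<open>r\<close>.\<close>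
definition digit_kernel :: "nat \<Rightarrow> nat \<Rightarrow> nat \<Rightarrow> real" where
  "digit_kernel j q r = p_ext d p (int j + int b * int q - int r)"

lemma digit_kernel_nonneg: "0 \<le> digit_kernel j q r"
  by (auto simp: digit_kernel_def p_ext_def intro!: less_imp_le p_pos)

lemma mass_Cons:
  assumes "set w \<subseteq> {..<b}"
  shows "mass (int q) (\<epsilon> # w) = (\<Sum>r<n. digit_kernel \<epsilon> q r * mass (int r) w)"
proof -
  have "mass (int q) (\<epsilon> # w) = (\<Sum>s<d. p s * mass (int \<epsilon> + int b * int q - int s) w)"
    unfolding mass_def
    by (subst self_similar[OF cell_borel]) (use b2 in \<open>simp add: vimage_cell_Cons add.commute[of "int \<epsilon>"]\<close>)
  also have "\<dots> = (\<Sum>r<n. digit_kernel \<epsilon> q r * mass (int r) w)"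
    unfolding digit_kernel_def using mass_eq_0[OF _ assms] by (intro sum_reindex_window)
  finally show ?thesis .
qed

section \<open>The masses of the unit intervals as the positive eigenvector\<close>

lemma prob_half_open:
  "x \<le> y \<Longrightarrow> \<eta>.prob {x ..< y} = \<eta>.prob {..<y} - \<eta>.prob {..<x}"
proof -
  assume "x \<le> y"
  then have "{x ..< y} = {..<y} - {..<x}" "{..<x} \<subseteq> {..<y}" by auto
  then show ?thesis using \<eta>.finite_measure_Diff[of "{..<y}" "{..<x}"] by simp
qed

lemma mass_split: "mass q [] = (\<Sum>\<epsilon><b. mass q [\<epsilon>])"
proof -
  let ?F = "\<lambda>\<epsilon>. \<eta>.prob {..<of_int q + real \<epsilon> / real b}"
  have "mass q [\<epsilon>] = ?F (Suc \<epsilon>) - ?F \<epsilon>" for \<epsilon>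
    using b2 by (simp add: mass_def cell_def word_value_def add_divide_distrib add.assoc
        add.commute[of "1 / real b"] prob_half_open)
  then have "(\<Sum>\<epsilon><b. mass q [\<epsilon>]) = ?F b - ?F 0"
    by (simp only: sum_lessThan_telescope[of ?F])
  also have "\<dots> = mass q []"
    using b2 by (simp add: mass_def cell_Nil prob_half_open)
  finally show ?thesis by simp
qed

lemma mass_total: "(\<Sum>q<n. mass (int q) []) = 1"
proof -
  let ?F = "\<lambda>q::nat. \<eta>.prob {..<real q}"
  have "mass (int q) [] = ?F (Suc q) - ?F q" for q
    by (simp add: mass_def cell_Nil prob_half_open add.commute)
  then have "(\<Sum>q<n. mass (int q) []) = ?F n - ?F 0"
    by (simp only: sum_lessThan_telescope[of ?F])
  moreover have "?F 0 = 0" by (rule prob_outside_support) auto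
  moreover have "?F n = 1"
  proof -
    have "\<eta>.prob {real n..} \<le> \<eta>.prob {max_sum..}"
      using real_a_of(2) by (intro \<eta>.finite_measure_mono) auto
    then have "\<eta>.prob {real n..} = 0" using prob_top_atom by (simp add: measure_le_0_iff)
    moreover have "UNIV - {real n..} = {..<real n}" by auto
    ultimately show ?thesis using \<eta>.prob_compl[of "{real n..}"] by simp
  qed
  ultimately show ?thesis by simp
qed

definition transfer :: "nat \<Rightarrow> nat \<Rightarrow> real" where
  "transfer q r = (\<Sum>j<b. digit_kernel j q r)"

lemma transfer_nonneg: "0 \<le> transfer q r"
  unfolding transfer_def by (intro sum_nonneg digit_kernel_nonneg)

lemma mass_fixed: "mass (int q) [] = (\<Sum>r<n. transfer q r * mass (int r) [])"
proof -
  have "mass (int q) [] = (\<Sum>j<b. \<Sum>r<n. digit_kernel j q r * mass (int r) [])"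
    unfolding mass_split[of "int q"] by (simp add: mass_Cons)
  also have "\<dots> = (\<Sum>r<n. \<Sum>j<b. digit_kernel j q r * mass (int r) [])"
    by (rule sum.swap)
  finally show ?thesis by (simp add: transfer_def sum_distrib_right)
qed

text \<open>As \<open>(q, j)\<close> varies, \<open>j + b q\<close> runs once through \<open>{..<n * b}\<close>, and this range contains the whole
  window of digits translated by \<open>r\<close>.\<close>
lemma transfer_column_sum:
  assumes "r < n"
  shows "(\<Sum>q<n. transfer q r) = 1"
proof -
  let ?f = "\<lambda>i. p_ext d p (int i - int r)"
  have "transfer q r = sum ?f {q * b..<q * b + b}" for q
    unfolding transfer_def digit_kernel_def
    by (rule sum.reindex_bij_witness[of _ "\<lambda>i. i - q * b" "\<lambda>j. q * b + j"])
      (auto simp: algebra_simps)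
  then have "(\<Sum>q<n. transfer q r) = sum ?f {..<n * b}"
    by (simp add: sum.nat_group)
  also have "\<dots> = sum ?f ((\<lambda>s. s + r) ` {..<d})"
  proof (rule sum.mono_neutral_right)
    show "(\<lambda>s. s + r) ` {..<d} \<subseteq> {..<n * b}" using d_bound assms by auto
    show "\<forall>i\<in>{..<n * b} - (\<lambda>s. s + r) ` {..<d}. ?f i = 0"
    proof
      fix i assume i: "i \<in> {..<n * b} - (\<lambda>s. s + r) ` {..<d}"
      have "\<not> (r \<le> i \<and> i - r < d)"
      proof
        assume "r \<le> i \<and> i - r < d"
        then have "i = i - r + r" "i - r \<in> {..<d}" by auto
        with i show False by blast
      qed
      then show "?f i = 0" by (auto simp: p_ext_def)
    qed
  qed auto
  also have "\<dots> = 1"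
    using p_sum by (subst sum.reindex) (auto simp: p_ext_def)
  finally show ?thesis .
qed

text \<open>The admissible positions \<open>b q - r + j\<close> meet \<open>{0..d - 1}\<close>: already \<open>j = 0\<close> works unless
  \<open>b q < r\<close>, and then \<open>r = b q + 1\<close>, so that \<open>j = 1\<close> hits the digit 0.\<close>
lemma transfer_adjacent_pos:
  assumes "q < n" "r \<le> Suc q" "q \<le> Suc r"
  shows "0 < transfer q r"
proof -
  define j where "j = (if int r \<le> int b * int q then 0 else 1 :: nat)"
  have le: "int q * 1 \<le> int q * int b" using b2 by (intro mult_left_mono) auto
  have "0 \<le> int j + int b * int q - int r \<and> int j + int b * int q - int r < int d"
    using assms index_bound[OF assms(1)] le b2 bd by (auto simp: j_def mult.commute)
  then have "0 < digit_kernel j q r" using p_pos by (auto simp: digit_kernel_def p_ext_def)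
  moreover have "j < b" using b2 by (auto simp: j_def)
  ultimately show ?thesis
    unfolding transfer_def by (intro sum_pos2[of _ j]) (auto simp: digit_kernel_nonneg)
qed

text \<open>A zero of \<open>v\<close> at \<open>q\<close> forces all terms of the sum for \<open>v q\<close> to vanish, hence spreads to the
  neighbours of \<open>q\<close>: first down to 0, and from there to every index.\<close>
lemma transfer_irreducible:
  assumes nonneg: "\<And>q. q < n \<Longrightarrow> 0 \<le> v q"
    and fixed: "\<And>q. q < n \<Longrightarrow> v q = (\<Sum>r<n. transfer q r * v r)"
    and zero: "q\<^sub>0 < n" "v q\<^sub>0 = 0"
  shows "q < n \<Longrightarrow> v q = 0"
proof -
  have step: "v r = 0" if "q < n" "v q = 0" "r < n" "r \<le> Suc q" "q \<le> Suc r" for q r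
  proof -
    have "(\<Sum>r<n. transfer q r * v r) = 0" using fixed[OF that(1)] that(2) by simp
    then have "transfer q r * v r = 0"
      using that(3) by (subst (asm) sum_nonneg_eq_0_iff) (auto simp: transfer_nonneg nonneg)
    then show ?thesis using transfer_adjacent_pos[OF that(1,4,5)] by simp
  qed
  have "v (q\<^sub>0 - i) = 0" for i
  proof (induction i)
    case (Suc i)
    show ?case by (rule step[OF _ Suc]) (use zero(1) in auto)
  qed (simp add: zero)
  from this[of q\<^sub>0] have "v 0 = 0" by simp
  then show "v q = 0" if "q < n" for q
    using that
  proof (induction q)
    case (Suc q)
    then show ?case using step[of q "Suc q"] by simp
  qed (use \<open>v 0 = 0\<close> in simp)
qed

lemma mass_pos:
  assumes "q < n"
  shows "0 < mass (int q) []"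
proof (rule ccontr)
  assume "\<not> 0 < mass (int q) []"
  then have "mass (int q) [] = 0" using mass_nonneg[of "int q" "[]"] by linarith
  then have "mass (int r) [] = 0" if "r < n" for r
    using transfer_irreducible[of "\<lambda>q. mass (int q) []" q r] that assms
      mass_nonneg mass_fixed by blast
  then show False using mass_total by simp
qed

text \<open>Summing the eigenvalue equation over the rows gives \<open>k = 1\<close>, because the columns sum to 1. If
  \<open>t\<close> is the least quotient of the entries of \<open>v\<close> and of the mass vector, then \<open>v\<close> minus \<open>t\<close> times the
  mass vector is a nonnegative fixed vector with a zero entry, hence zero; comparing the totals gives
  \<open>t = 1\<close>.\<close>
lemma positive_eigenvector_unique:
  assumes pos: "\<And>q. q < n \<Longrightarrow> 0 < v q" and total: "(\<Sum>q<n. v q) = 1"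
    and eigen: "\<And>q. q < n \<Longrightarrow> (\<Sum>r<n. transfer q r * v r) = k * v q"
    and q: "q < n"
  shows "v q = mass (int q) []"
proof -
  let ?C = "\<lambda>q. mass (int q) []"
  have "k = (\<Sum>q<n. k * v q)" using total by (simp add: sum_distrib_left[symmetric])
  also have "\<dots> = (\<Sum>q<n. \<Sum>r<n. transfer q r * v r)" using eigen by simp
  also have "\<dots> = (\<Sum>r<n. (\<Sum>q<n. transfer q r) * v r)"
    by (subst sum.swap) (simp add: sum_distrib_right)
  also have "\<dots> = 1" using transfer_column_sum total by simp
  finally have k: "k = 1" .
  let ?R = "(\<lambda>q. v q / ?C q) ` {..<n}"
  have R: "finite ?R" "?R \<noteq> {}" using n_pos by auto
  define t where "t = Min ?R"
  obtain q\<^sub>0 where q0: "q\<^sub>0 < n" "t = v q\<^sub>0 / ?C q\<^sub>0"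
    using Min_in[OF R] by (auto simp: t_def)
  have t_le: "t \<le> v r / ?C r" if "r < n" for r
    unfolding t_def using that R by (intro Min_le) auto
  have "0 \<le> v r - t * ?C r" if "r < n" for r
    using t_le[OF that] mass_pos[OF that] by (simp add: pos_le_divide_eq)
  moreover have "v r - t * ?C r = (\<Sum>s<n. transfer r s * (v s - t * ?C s))" if "r < n" for r
  proof -
    have "(\<Sum>s<n. transfer r s * (v s - t * ?C s)) =
        (\<Sum>s<n. transfer r s * v s) - t * (\<Sum>s<n. transfer r s * ?C s)"
      by (simp add: right_diff_distrib sum_subtractf sum_distrib_left mult.left_commute)
    then show ?thesis using eigen[OF that] k mass_fixed[of r] by simp
  qed
  moreover have "v q\<^sub>0 - t * ?C q\<^sub>0 = 0" using q0 mass_pos[OF q0(1)] by simp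
  ultimately have proportional: "v r - t * ?C r = 0" if "r < n" for r
    using transfer_irreducible[of "\<lambda>r. v r - t * ?C r" q\<^sub>0 r] that q0(1) by blast
  have "1 = (\<Sum>r<n. t * ?C r)" using proportional total by simp
  then have "t = 1" using mass_total by (simp add: sum_distrib_left[symmetric])
  then show ?thesis using proportional[OF q] by simp
qed

lemma M_mat_index: "q < n \<Longrightarrow> r < n \<Longrightarrow> M_mat b d p j $$ (q, r) = digit_kernel j q r"
  by (simp add: M_mat_def digit_kernel_def n_def)

lemma M_sum_index: "q < n \<Longrightarrow> r < n \<Longrightarrow> M_sum b d p $$ (q, r) = transfer q r"
  unfolding M_sum_def n_def[symmetric] by (simp add: M_mat_index transfer_def)

lemma M_sum_mult:
  assumes "v \<in> carrier_vec n" "q < n"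
  shows "(M_sum b d p *\<^sub>v v) $ q = (\<Sum>r<n. transfer q r * v $ r)"
proof -
  have "M_sum b d p \<in> carrier_mat n n" by (simp add: M_sum_def n_def)
  then show ?thesis
    using assms by (auto simp: scalar_prod_def M_sum_index atLeast0LessThan intro!: sum.cong)
qed

lemma C_vec_eq: "C_vec b d p = vec n (\<lambda>q. mass (int q) [])"
  unfolding C_vec_def
proof (rule the_equality)
  let ?C = "vec n (\<lambda>q. mass (int q) [])"
  have dim: "dim_row (M_sum b d p) = n" by (simp add: M_sum_def n_def)
  have "M_sum b d p *\<^sub>v ?C = 1 \<cdot>\<^sub>v ?C"
  proof (rule eq_vecI)
    fix q assume "q < dim_vec (1 \<cdot>\<^sub>v ?C)"
    then have q: "q < n" by simp
    show "(M_sum b d p *\<^sub>v ?C) $ q = (1 \<cdot>\<^sub>v ?C) $ q"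
      using q mass_fixed[of q] by (subst M_sum_mult) auto
  qed (simp add: dim)
  moreover have "?C \<noteq> 0\<^sub>v n"
  proof
    assume "?C = 0\<^sub>v n"
    then have "?C $ 0 = 0\<^sub>v n $ 0" by simp
    then show False using n_pos mass_pos[of 0] by simp
  qed
  ultimately have "eigenvector (M_sum b d p) ?C 1"
    by (simp add: eigenvector_def dim)
  then show "(\<exists>k. eigenvector (M_sum b d p) ?C k) \<and> (\<forall>i<dim_vec ?C. 0 < ?C $ i) \<and>
      (\<Sum>i<dim_vec ?C. ?C $ i) = 1"
    using mass_pos mass_total by auto
next
  fix v assume v: "(\<exists>k. eigenvector (M_sum b d p) v k) \<and> (\<forall>i<dim_vec v. 0 < v $ i) \<and>
      (\<Sum>i<dim_vec v. v $ i) = 1"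
  have dim: "dim_row (M_sum b d p) = n" by (simp add: M_sum_def n_def)
  from v obtain k where k: "v \<in> carrier_vec n" "M_sum b d p *\<^sub>v v = k \<cdot>\<^sub>v v"
    by (auto simp: eigenvector_def dim)
  have "(\<Sum>r<n. transfer q r * v $ r) = k * v $ q" if "q < n" for q
    using M_sum_mult[OF k(1) that] k that by simp
  then have "v $ q = mass (int q) []" if "q < n" for q
    using positive_eigenvector_unique[of "\<lambda>q. v $ q" k q] v k(1) that by auto
  then show "v = vec n (\<lambda>q. mass (int q) [])"
    using k(1) by (intro eq_vecI) auto
qed

end

section \<open>The symbolic measures\<close>

lemma cylinder_measure_cong:
  assumes "cylinder_measure m f \<mu>" and "\<And>w. w \<in> lists {..<m} \<Longrightarrow> w \<noteq> [] \<Longrightarrow> f w = g w"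
  shows "cylinder_measure m g \<mu>"
  using assms by (simp add: cylinder_measure_def)

context bernoulli_digits
begin

abbreviation unit_mass :: "nat \<Rightarrow> real" where
  "unit_mass q \<equiv> mass (int q) []"

lemma mass_eq_word_act:
  "set w \<subseteq> {..<b} \<Longrightarrow> mass (int q) w = word_act n digit_kernel w unit_mass q"
  by (induction w arbitrary: q) (auto simp: mass_Cons)

lemma translate_unit_interval: "(\<lambda>x. real q + x) ` {0..<1} = cell b (int q) []"
  by (simp add: cell_Nil add.commute)

lemma eta_q_weight_eq: "eta_q_weight b d p q w = mass (int q) w / unit_mass q"
  unfolding eta_q_weight_def translate_word_interval translate_unit_interval mass_def ..

lemma eta_sum_weight_eq:
  assumes "set w \<subseteq> {..<b}"
  shows "eta_sum_weight b d p w = (\<Sum>q<n. mass (int q) w)"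
  unfolding eta_sum_weight_def translate_word_interval mass_def[symmetric]
  using mass_eq_0[OF _ assms] by (intro suminf_finite) auto

text \<open>Row \<open>q\<close> of the conjugated matrices sums to the total mass of the \<open>b\<close> subintervals of \<open>[q, q + 1)\<close>
  divided by the mass of \<open>[q, q + 1)\<close>, that is, to 1. The initial law \<open>c\<close> mixes the conditional measures
  on the unit intervals.\<close>
lemma ex_sofic_mixture:
  assumes c0: "\<And>q. q < n \<Longrightarrow> 0 \<le> c q" and c1: "(\<Sum>q<n. c q) = 1"
  shows "\<exists>\<nu>. cylinder_measure b (\<lambda>w. \<Sum>q<n. c q * (mass (int q) w / unit_mass q)) \<nu> \<and> sofic b \<nu>"
proof -
  let ?N = "\<lambda>j q r. digit_kernel j q r * unit_mass r / unit_mass q"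
  have row: "(\<Sum>j<b. \<Sum>r<n. ?N j q r) = 1" if "q < n" for q
  proof -
    have "(\<Sum>j<b. \<Sum>r<n. ?N j q r) = (\<Sum>j<b. mass (int q) [j]) / unit_mass q"
      by (simp add: mass_Cons sum_divide_distrib)
    then show ?thesis using mass_pos[OF that] by (simp add: mass_split[symmetric])
  qed
  have "\<exists>\<mu>. markov_measure (n * b) (block_init n b c ?N) (block_trans n b ?N) \<mu> \<and>
      cylinder_measure b (\<lambda>w. \<Sum>q<n. c q * word_act n ?N w (\<lambda>_. 1) q)
        (distr \<mu> (seq_space b) (\<lambda>\<omega> k. \<omega> k div n))"
    by (rule block_chain) (simp_all add: row c0 c1 digit_kernel_nonneg mass_nonneg)
  then obtain \<mu> where \<mu>: "markov_measure (n * b) (block_init n b c ?N) (block_trans n b ?N) \<mu>"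
    and cyl: "cylinder_measure b (\<lambda>w. \<Sum>q<n. c q * word_act n ?N w (\<lambda>_. 1) q)
        (distr \<mu> (seq_space b) (\<lambda>\<omega> k. \<omega> k div n))"
    by blast
  have "(\<Sum>q<n. c q * word_act n ?N w (\<lambda>_. 1) q) = (\<Sum>q<n. c q * (mass (int q) w / unit_mass q))"
    if w: "w \<in> lists {..<b}" for w
  proof (intro sum.cong refl)
    have wb: "set w \<subseteq> {..<b}" using w by auto
    fix q assume "q \<in> {..<n}"
    moreover have "unit_mass r \<noteq> 0" if "r < n" for r using mass_pos[OF that] by simp
    ultimately have "word_act n ?N w (\<lambda>_. 1) q = mass (int q) w / unit_mass q"
      by (subst word_act_scale) (auto simp: mass_eq_word_act[OF wb])
    then show "c q * word_act n ?N w (\<lambda>_. 1) q = c q * (mass (int q) w / unit_mass q)"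
      by simp
  qed
  with cyl have "cylinder_measure b (\<lambda>w. \<Sum>q<n. c q * (mass (int q) w / unit_mass q))
      (distr \<mu> (seq_space b) (\<lambda>\<omega> k. \<omega> k div n))"
    by (rule cylinder_measure_cong)
  with sofic_block_image[OF \<mu>] show ?thesis by blast
qed

text \<open>The initial law is the point mass at \<open>q\<close>.\<close>
lemma eta_q_symb_sofic:
  assumes "0 < measure \<eta> ((\<lambda>x. real q + x) ` {0..<1})"
  shows "cylinder_measure b (eta_q_weight b d p q) (eta_q_symb b d p q) \<and>
    sofic b (eta_q_symb b d p q)"
proof -
  have q: "q < n"
  proof (rule ccontr)
    assume "\<not> q < n"
    then have "unit_mass q = 0" by (intro mass_eq_0) auto
    then show False using assms unfolding translate_unit_interval mass_def by simp
  qed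
  let ?c = "\<lambda>r. if r = q then 1 else 0 :: real"
  have "0 \<le> ?c r" "(\<Sum>r<n. ?c r) = 1" for r using q by simp_all
  then obtain \<nu> where \<nu>: "sofic b \<nu>"
    "cylinder_measure b (\<lambda>w. \<Sum>r<n. ?c r * (mass (int r) w / unit_mass r)) \<nu>"
    using ex_sofic_mixture[of ?c] by blast
  have "(\<Sum>r<n. ?c r * (mass (int r) w / unit_mass r)) = eta_q_weight b d p q w" for w
  proof -
    have "(\<Sum>r<n. ?c r * (mass (int r) w / unit_mass r)) =
        (\<Sum>r<n. if r = q then mass (int r) w / unit_mass r else 0)"
      by (intro sum.cong) auto
    also have "\<dots> = mass (int q) w / unit_mass q" using q by simp
    finally show ?thesis by (simp only: eta_q_weight_eq)
  qed
  then have cyl: "cylinder_measure b (eta_q_weight b d p q) \<nu>"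
    using cylinder_measure_cong[OF \<nu>(2)] by blast
  show ?thesis
    unfolding eta_q_symb_def measure_of_cylinders_eqI[OF cyl] using cyl \<nu>(1) by blast
qed

text \<open>Weighting the conditional measures with the masses of the unit intervals cancels the
  normalisation.\<close>
lemma eta_sum_symb_sofic:
  "cylinder_measure b (eta_sum_weight b d p) (eta_sum_symb b d p) \<and> sofic b (eta_sum_symb b d p)"
proof -
  obtain \<nu> where \<nu>: "sofic b \<nu>"
    "cylinder_measure b (\<lambda>w. \<Sum>q<n. unit_mass q * (mass (int q) w / unit_mass q)) \<nu>"
    using ex_sofic_mixture[of unit_mass, OF mass_nonneg mass_total] by blast
  have "(\<Sum>q<n. unit_mass q * (mass (int q) w / unit_mass q)) = eta_sum_weight b d p w"
    if "w \<in> lists {..<b}" for w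
  proof -
    have "unit_mass q \<noteq> 0" if "q < n" for q using mass_pos[OF that] by simp
    then show ?thesis using that by (subst eta_sum_weight_eq) (auto intro!: sum.cong)
  qed
  with \<nu>(2) have cyl: "cylinder_measure b (eta_sum_weight b d p) \<nu>"
    by (rule cylinder_measure_cong)
  show ?thesis
    unfolding eta_sum_symb_def measure_of_cylinders_eqI[OF cyl] using cyl \<nu>(1) by blast
qed

text \<open>Reading the word backwards exchanges the roles of the two vectors in the product: the chain with
  the transposed matrices starts from the masses of the unit intervals and ends with the vector 1.\<close>
lemma eta'_weight_eq:
  assumes w: "w \<in> lists {..<b}" "w \<noteq> []"
  shows "eta'_weight b d p w =
    (\<Sum>q<n. unit_mass q * word_act n (\<lambda>j q r. digit_kernel j r q) w (\<lambda>_. 1) q)"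
proof -
  have wb: "set (rev w) \<subseteq> {..<b}" using w by auto
  have "eta'_weight b d p w = eta_sum_weight b d p (rev w)"
    using eta_sum_symb_sofic w unfolding eta'_weight_def cylinder_measure_def by auto
  also have "\<dots> = (\<Sum>q<n. 1 * word_act n digit_kernel (rev w) unit_mass q)"
    using eta_sum_weight_eq[OF wb] by (simp add: mass_eq_word_act[OF wb])
  also have "\<dots> = (\<Sum>q<n. word_act n (\<lambda>j q r. digit_kernel j r q) w (\<lambda>_. 1) q * unit_mass q)"
    by (subst word_act_transpose) simp
  finally show ?thesis by (simp add: mult.commute)
qed

lemma P_eta'_eq: "P_eta' b d p = block_trans n b (\<lambda>j q r. digit_kernel j r q)"
proof (rule eq_matI)
  fix i j assume "i < dim_row (block_trans n b (\<lambda>j q r. digit_kernel j r q))"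
    "j < dim_col (block_trans n b (\<lambda>j q r. digit_kernel j r q))"
  then have ij: "i < n * b" "j < n * b" by (simp_all add: block_trans_def)
  have dims: "dim_row (M_mat b d p k) = n" "dim_col (M_mat b d p k) = n" for k
    by (simp_all add: M_mat_def n_def)
  show "P_eta' b d p $$ (i, j) = block_trans n b (\<lambda>j q r. digit_kernel j r q) $$ (i, j)"
    unfolding P_eta'_def Let_def n_def[symmetric]
    using ij n_pos by (simp add: block_trans_def dims M_mat_index)
qed (simp_all add: P_eta'_def block_trans_def Let_def n_def)

text \<open>The vector \<open>initial_eta'\<close> is the law after one move of the chain started from \<open>C\<close>, so it is the
  initial vector that the construction of the block chain provides.\<close>
lemma initial_eta'_eq:
  "initial_eta' b d p = block_init n b unit_mass (\<lambda>j q r. digit_kernel j r q)"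
proof (rule eq_vecI)
  have dim: "dim_row (P_eta' b d p) = n * b" "dim_col (P_eta' b d p) = n * b"
    by (simp_all add: P_eta'_eq block_trans_def)
  have C: "C_blocks b d p = vec (n * b) (\<lambda>i. unit_mass (i mod n))"
    unfolding C_blocks_def Let_def n_def[symmetric]
    using n_pos by (intro eq_vecI) (auto simp: C_vec_eq)
  fix i assume "i < dim_vec (block_init n b unit_mass (\<lambda>j q r. digit_kernel j r q))"
  then have i: "i < n * b" by (simp add: block_init_def)
  have "(transpose_mat (P_eta' b d p) *\<^sub>v C_blocks b d p) $ i =
      (\<Sum>k<n * b. P_eta' b d p $$ (k, i) * unit_mass (k mod n))"
    using i by (simp add: C scalar_prod_def dim atLeast0LessThan)
  also have "\<dots> = (\<Sum>k<n * b. digit_kernel (i div n) (i mod n) (k mod n) * unit_mass (k mod n))"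
    using i by (intro sum.cong) (auto simp: P_eta'_eq block_trans_def)
  \<comment> \<open>The \<open>b\<close> block rows are equal, so the sum over all states is \<open>b\<close> times the sum over one block.\<close>
  also have "\<dots> = real b * (\<Sum>q<n. digit_kernel (i div n) (i mod n) q * unit_mass q)"
    unfolding sum_block_states by (simp add: block_letter)
  finally show "initial_eta' b d p $ i =
      block_init n b unit_mass (\<lambda>j q r. digit_kernel j r q) $ i"
    using i b2 by (simp add: initial_eta'_def dim block_init_def mult.commute)
qed (simp add: initial_eta'_def P_eta'_eq block_trans_def block_init_def)

lemma eta'_markov_image:
  "\<exists>\<mu>. markov_measure (n * b) (initial_eta' b d p) (P_eta' b d p) \<mu> \<and>
    cylinder_measure b (eta'_weight b d p) (eta' b d p) \<and>
    eta' b d p = distr \<mu> (seq_space b) (\<lambda>\<omega> k. \<omega> k div n)"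
proof -
  let ?N = "\<lambda>j q r. digit_kernel j r q"
  have row: "(\<Sum>j<b. \<Sum>r<n. ?N j q r) = 1" if "q < n" for q
    using transfer_column_sum[OF that] unfolding transfer_def by (subst sum.swap)
  have "\<exists>\<mu>. markov_measure (n * b) (block_init n b unit_mass ?N) (block_trans n b ?N) \<mu> \<and>
      cylinder_measure b (\<lambda>w. \<Sum>q<n. unit_mass q * word_act n ?N w (\<lambda>_. 1) q)
        (distr \<mu> (seq_space b) (\<lambda>\<omega> k. \<omega> k div n))"
    by (rule block_chain) (simp_all add: row digit_kernel_nonneg mass_nonneg mass_total)
  then obtain \<mu> where \<mu>: "markov_measure (n * b) (initial_eta' b d p) (P_eta' b d p) \<mu>"
    and cyl: "cylinder_measure b (\<lambda>w. \<Sum>q<n. unit_mass q * word_act n ?N w (\<lambda>_. 1) q)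
        (distr \<mu> (seq_space b) (\<lambda>\<omega> k. \<omega> k div n))"
    unfolding P_eta'_eq initial_eta'_eq by blast
  from cyl have cyl': "cylinder_measure b (eta'_weight b d p)
      (distr \<mu> (seq_space b) (\<lambda>\<omega> k. \<omega> k div n))"
    by (rule cylinder_measure_cong) (simp add: eta'_weight_eq)
  show ?thesis
    unfolding eta'_def measure_of_cylinders_eqI[OF cyl'] using \<mu> cyl' by blast
qed

end

theorem corollary18:
  fixes b d :: nat and p :: "nat \<Rightarrow> real"
  assumes "2 \<le> b" and "b \<le> d"
    and "\<And>i. i < d \<Longrightarrow> 0 < p i" and "(\<Sum>i<d. p i) = 1"
  shows
    "(\<forall>q. 0 < measure (bernoulli_conv b d p) ((\<lambda>x. real q + x) ` {0..<1}) \<longrightarrow>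
        cylinder_measure b (eta_q_weight b d p q) (eta_q_symb b d p q) \<and>
        sofic b (eta_q_symb b d p q)) \<and>
     (cylinder_measure b (eta_sum_weight b d p) (eta_sum_symb b d p) \<and>
        sofic b (eta_sum_symb b d p)) \<and>
     (cylinder_measure b (eta'_weight b d p) (eta' b d p) \<and>
        sofic b (eta' b d p)) \<and>
     (\<exists>\<mu>. markov_measure ((a_of b d + 1) * b) (initial_eta' b d p) (P_eta' b d p) \<mu> \<and>
        eta' b d p = distr \<mu> (seq_space b) (\<lambda>\<omega> n. \<omega> n div (a_of b d + 1)))"
proof -
  interpret bernoulli_digits b d p
    using assms by unfold_locales
  obtain \<mu> where \<mu>: "markov_measure (n * b) (initial_eta' b d p) (P_eta' b d p) \<mu>"
    and cyl: "cylinder_measure b (eta'_weight b d p) (eta' b d p)"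
    and image: "eta' b d p = distr \<mu> (seq_space b) (\<lambda>\<omega> k. \<omega> k div n)"
    using eta'_markov_image by blast
  have "sofic b (eta' b d p)"
    unfolding image by (rule sofic_block_image[OF \<mu>])
  with \<mu> cyl image eta_q_symb_sofic eta_sum_symb_sofic show ?thesis
    unfolding n_def by blast
qed

end
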